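(* Let $(\lambda^k)$ be the (random) iterates of the SGS-CD algorithm applied to $F$ with stepsize $1/L$. Then SGS-CD converges as $$\mathbb{E}\left[F(\lambda^{k+1})\mid\lambda^k\right]-F(\lambda^* )\;\le\;\left(1-\frac{\sigma_{\mathrm{SM}}}{L\,n}\right)\left[F(\lambda^k)-F(\lambda^* )\right],$$ with $$\frac{\sigma_A}{N_{\max}}\;\le\;\sigma_{\mathrm{SM}}\;\le\;2\sigma_A .$$
   Context: Setting. $\mathcal{G}=(\mathcal V,\mathcal E)$ is a finite undirected graph with $n=|\mathcal V|$ nodes and $E=|\mathcal E|$ edges; $\ell\equiv(i,j)$ means that edge $\ell$ joins nodes $i$ and $j$. $A\in\mathbb{R}^{n\times E}$ is the incidence matrix: column $\ell\equiv(i,j)$ has one entry $1$ and one entry $-1$, in rows $i$ and $j$ (the sign choice is irrelevant), and zeros elsewhere. For $i=1,\dots,n$, $f_i:\mathbb{R}\to\mathbb{R}$ is $M_i$-smooth and $\mu_i$-strongly convex, i.e. there are constants $M_i\ge\mu_i>0$ such that for all $x,y$: $f_i(x)+f_i'(x)(y-x)+\frac{\mu_i}{2}(y-x)^2\le f_i(y)\le f_i(x)+f_i'(x)(y-x)+\frac{M_i}{2}(y-x)^2$. Put $\mu_{\min}=\min_i\mu_i$ and $M_{\max}=\max_iM_i$. $f_i^*(y)=\sup_{x\in\mathbb{R}}(yx-f_i(x))$ is the Fenchel conjugate, and $F:\mathbb{R}^E\to\mathbb{R}$ is $F(\lambda)=\sum_{i=1}^n f_i^*(u_i^TA\lambda)$,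 with $u_i$ the $i$-th standard basis vector of $\mathbb{R}^n$. $\lambda^*$ is a minimizer of $F$. $\nabla_\ell F=\partial F/\partial\lambda_\ell$ and $e_\ell$ is the $\ell$-th standard basis vector of $\mathbb{R}^E$. Constants. Let $\gamma_{\max}$ and $\gamma_{\min}^+$ be the largest and the smallest non-zero eigenvalue of $A^TA$. $L=\gamma_{\max}/\mu_{\min}$; $F$ is $L$-smooth. $\sigma_A=\gamma^+_{\min}/M_{\max}$; $F$ is $\sigma_A$-strongly convex in the semi-norm $\|x\|_A=(x^TA^+Ax)^{1/2}$, with $A^+$ the pseudo-inverse of $A$. $\mathcal S_i$ is the set of edges incident to node $i$, $N_i=|\mathcal S_i|$, $N_{\max}=\max_iN_i$. $\|x\|_{\mathrm{SM}}=\sqrt{\sum_{i=1}^n\max_{\ell\in\mathcal S_i}x_\ell^2}$ is a norm on $\mathbb{R}^E$, with dual norm $\|z\|_{\mathrm{SM}}^*=\sup\{z^Tx:\|x\|_{\mathrm{SM}}\le1\}$. $\sigma_{\mathrm{SM}}$ denotes the strong convexity constant of $F$ in $\|\cdot\|_{\mathrm{SM}}^*$, i.e. the constant in $F(y)\ge F(x)+\langle\nabla F(x),y-x\rangle+\frac{\sigma_{\mathrm{SM}}}{2}(\|y-x\|_{\mathrm{SM}}^* )^2$. SGS-CD (Setwise Gauss-Southwell Coordinate Descent): at each iteration $k$ a node $i$ is drawn uniformly from $\{1,\dots,n\}$; then $\ell=\arg\max_{m\in\mathcal S_i}(\nabla_mF(\lambda^k))^2$ is chosen and $\lambda^{k+1}=\lambda^k-\frac1L\nabla_\ell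 F(\lambda^k)e_\ell$.
   Formalization: Strong convexity in the dual SM norm is required only for y-x in range(A^T), as it fails on cycles; σ_SM ≤ 2σ_A can fail for F's best constant, so it is proved with F's best constant in ‖·‖_A for σ_A, and literally for the best σ_SM valid for all F with moduli μ_min, M_max. *)

theory Defs
  imports "HOL-Probability.Probability"
begin

section \<open>Graph and incidence matrix\<close>

text \<open>
  Nodes are the elements of a finite type \<open>'n\<close>, edges the elements of a finite type \<open>'e\<close> (so there is at
  least one edge), and \<open>ends l\<close> is the set of the two nodes joined by edge \<open>l\<close>. Vectors in
  \<open>real^'e\<close> are indexed by edges; a matrix of type \<open>real^'e^'n\<close> has rows \<open>'n\<close> and columns \<open>'e\<close>.
\<close>

definition is_incidence_matrix :: "('e \<Rightarrow> 'n set) \<Rightarrow> real^'e^'n \<Rightarrow> bool" where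
  "is_incidence_matrix ends A \<longleftrightarrow>
     (\<forall>l. \<exists>i j. i \<noteq> j \<and> ends l = {i, j} \<and> A $ i $ l = 1 \<and> A $ j $ l = -1 \<and>
        (\<forall>k. k \<notin> {i, j} \<longrightarrow> A $ k $ l = 0))"

definition incident_edges :: "('e \<Rightarrow> 'n set) \<Rightarrow> 'n \<Rightarrow> 'e set" where
  "incident_edges ends i = {l. i \<in> ends l}"

definition max_degree :: "('e::finite \<Rightarrow> 'n::finite set) \<Rightarrow> nat" where
  "max_degree ends = Max (range (\<lambda>i. card (incident_edges ends i)))"

definition is_eigenvalue :: "real^'m^'m \<Rightarrow> real \<Rightarrow> bool" where
  "is_eigenvalue B c \<longleftrightarrow> (\<exists>v. v \<noteq> 0 \<and> B *v v = c *\<^sub>R v)"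

definition gamma_max :: "real^'e^'n \<Rightarrow> real" where
  "gamma_max A = Max {c. is_eigenvalue (transpose A ** A) c}"

definition gamma_min_pos :: "real^'e^'n \<Rightarrow> real" where
  "gamma_min_pos A = Min {c. c \<noteq> 0 \<and> is_eigenvalue (transpose A ** A) c}"

text \<open>The Moore--Penrose pseudo-inverse, through the four Penrose equations.\<close>

definition pseudo_inverse :: "real^'e^'n \<Rightarrow> real^'n^'e" where
  "pseudo_inverse A =
     (THE X. A ** X ** A = A \<and> X ** A ** X = X \<and>
        transpose (A ** X) = A ** X \<and> transpose (X ** A) = X ** A)"

section \<open>The dual objective\<close>

definition smooth_strongly_convex :: "real \<Rightarrow> real \<Rightarrow> (real \<Rightarrow> real) \<Rightarrow> bool" where
  "smooth_strongly_convex \<mu> M f \<longleftrightarrow>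
     0 < \<mu> \<and> \<mu> \<le> M \<and> (\<forall>x. f field_differentiable at x) \<and>
     (\<forall>x y. f x + deriv f x * (y - x) + \<mu> / 2 * (y - x)\<^sup>2 \<le> f y \<and>
            f y \<le> f x + deriv f x * (y - x) + M / 2 * (y - x)\<^sup>2)"

text \<open>
  For the strongly convex functions considered here the supremum is that of a nonempty set bounded
  above, so the conjugate is real-valued.
\<close>

definition fenchel_conjugate :: "(real \<Rightarrow> real) \<Rightarrow> real \<Rightarrow> real" where
  "fenchel_conjugate f y = (SUP x. y * x - f x)"

definition dual_objective :: "real^'e^'n \<Rightarrow> ('n \<Rightarrow> real \<Rightarrow> real) \<Rightarrow> real^'e \<Rightarrow> real" where
  "dual_objective A f x = (\<Sum>i\<in>UNIV. fenchel_conjugate (f i) ((A *v x) $ i))"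

definition partial_deriv :: "(real^'e \<Rightarrow> real) \<Rightarrow> 'e \<Rightarrow> real^'e \<Rightarrow> real" where
  "partial_deriv F l x = deriv (\<lambda>t. F (x + t *\<^sub>R axis l 1)) 0"

definition gradient :: "(real^'e \<Rightarrow> real) \<Rightarrow> real^'e \<Rightarrow> real^'e" where
  "gradient F x = (\<chi> l. partial_deriv F l x)"

section \<open>Norms and strong convexity\<close>

definition seminorm_A :: "real^'e^'n \<Rightarrow> real^'e \<Rightarrow> real" where
  "seminorm_A A x = sqrt (x \<bullet> ((pseudo_inverse A ** A) *v x))"

text \<open>A node without incident edges contributes nothing to the sum.\<close>

definition norm_SM :: "('e \<Rightarrow> 'n set) \<Rightarrow> real^'e \<Rightarrow> real" where
  "norm_SM ends x =
     sqrt (\<Sum>i\<in>UNIV. if incident_edges ends i = {} then 0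
                       else Max ((\<lambda>l. (x $ l)\<^sup>2) ` incident_edges ends i))"

definition dual_norm_SM :: "('e \<Rightarrow> 'n set) \<Rightarrow> real^'e \<Rightarrow> real" where
  "dual_norm_SM ends z = (SUP x\<in>{x. norm_SM ends x \<le> 1}. z \<bullet> x)"

text \<open>
  \<open>V\<close> is the space of admissible directions. If the graph has a cycle, then \<open>dual_objective A f\<close> is
  constant along the nontrivial kernel of \<open>A\<close>, hence cannot be strongly convex in a genuine norm
  unless the directions are restricted to the orthogonal complement of this kernel, which is the
  range of the transpose of \<open>A\<close>. For acyclic graphs that range is the whole space.
\<close>

definition strongly_convex_wrt ::
    "(real^'e \<Rightarrow> real) \<Rightarrow> (real^'e) set \<Rightarrow> (real^'e \<Rightarrow> real) \<Rightarrow> real \<Rightarrow> bool" where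
  "strongly_convex_wrt N V F \<sigma> \<longleftrightarrow>
     (\<forall>x y. y - x \<in> V \<longrightarrow> F y \<ge> F x + gradient F x \<bullet> (y - x) + \<sigma> / 2 * (N (y - x))\<^sup>2)"

definition row_space :: "real^'e^'n \<Rightarrow> (real^'e) set" where
  "row_space A = range (\<lambda>v. transpose A *v v)"

text \<open>
  The best constant shared by all functions of a family; a singleton family gives the strong
  convexity constant of a single function.
\<close>

definition strong_convexity_constant ::
    "(real^'e \<Rightarrow> real) \<Rightarrow> (real^'e) set \<Rightarrow> (real^'e \<Rightarrow> real) set \<Rightarrow> real" where
  "strong_convexity_constant N V \<F> = Sup {\<sigma>. \<forall>F\<in>\<F>. strongly_convex_wrt N V F \<sigma>}"

definition const_A :: "real^'e^'n \<Rightarrow> (real^'e \<Rightarrow> real) set \<Rightarrow> real" where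
  "const_A A \<F> = strong_convexity_constant (seminorm_A A) UNIV \<F>"

definition const_SM :: "('e \<Rightarrow> 'n set) \<Rightarrow> real^'e^'n \<Rightarrow> (real^'e \<Rightarrow> real) set \<Rightarrow> real" where
  "const_SM ends A \<F> = strong_convexity_constant (dual_norm_SM ends) (row_space A) \<F>"

text \<open>
  All dual objectives on the given graph whose local functions have the moduli \<open>\<mu>\<close> and \<open>M\<close>. The number
  \<open>gamma_min_pos A / M\<close> is the best constant in \<open>seminorm_A A\<close> for this class; a single member can
  have a larger one. On one edge with \<open>f\<^sub>1 x = x\<^sup>2 / 2\<close>, \<open>f\<^sub>2 x = x\<^sup>2\<close> one has \<open>M = 2\<close>,
  \<open>gamma_min_pos A / M = 1\<close>, \<open>F x = (3 / 4) * x\<^sup>2\<close>, and the best constants of \<open>F\<close> are \<open>3 / 2\<close> in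
  \<open>seminorm_A A\<close> and \<open>3\<close> in \<open>dual_norm_SM ends\<close>.
\<close>

definition dual_class :: "real^'e^'n \<Rightarrow> real \<Rightarrow> real \<Rightarrow> (real^'e \<Rightarrow> real) set" where
  "dual_class A \<mu> M = {dual_objective A g | g. \<forall>i. smooth_strongly_convex \<mu> M (g i)}"

section \<open>Setwise Gauss-Southwell coordinate descent\<close>

text \<open>
  One update at node \<open>i\<close>, as a relation because ties in the argmax may be broken in any way. A node
  without incident edges leaves the iterate unchanged.
\<close>

definition sgs_step ::
    "('e \<Rightarrow> 'n set) \<Rightarrow> (real^'e \<Rightarrow> real) \<Rightarrow> real \<Rightarrow> 'n \<Rightarrow> real^'e \<Rightarrow> real^'e \<Rightarrow> bool" where
  "sgs_step ends F L i x x' \<longleftrightarrow>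
     (if incident_edges ends i = {} then x' = x
      else \<exists>l\<in>incident_edges ends i.
        (\<forall>m\<in>incident_edges ends i. (partial_deriv F m x)\<^sup>2 \<le> (partial_deriv F l x)\<^sup>2) \<and>
        x' = x - ((1 / L) * partial_deriv F l x) *\<^sub>R axis l 1)"

text \<open>
  \<open>lam k\<close> is the \<open>k\<close>-th iterate and \<open>node k\<close> the node drawn at iteration \<open>k\<close>, uniformly and
  independently of the iterates up to \<open>lam k\<close>. Independence is stated for the sigma-algebras generated
  by the history and by the draw, since \<open>indep_var\<close> needs a common codomain.
\<close>

definition sgs_cd_process ::
    "('e::finite \<Rightarrow> 'n::finite set) \<Rightarrow> (real^'e \<Rightarrow> real) \<Rightarrow> real \<Rightarrow> real^'e \<Rightarrow>
     'w measure \<Rightarrow> (nat \<Rightarrow> 'w \<Rightarrow> real^'e) \<Rightarrow> (nat \<Rightarrow> 'w \<Rightarrow> 'n) \<Rightarrow> bool" where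
  "sgs_cd_process ends F L x0 P lam node \<longleftrightarrow>
     prob_space P \<and>
     (\<forall>k. lam k \<in> borel_measurable P) \<and>
     (\<forall>k. node k \<in> measurable P (count_space UNIV)) \<and>
     (\<forall>k. distr P (count_space UNIV) (node k) = uniform_count_measure UNIV) \<and>
     (\<forall>k. prob_space.indep_set P
        (sets (vimage_algebra (space P) (\<lambda>\<omega>. \<lambda>j\<in>{..k}. lam j \<omega>) (Pi\<^sub>M {..k} (\<lambda>_. borel))))
        (sets (vimage_algebra (space P) (node k) (count_space UNIV)))) \<and>
     (\<forall>\<omega>\<in>space P. lam 0 \<omega> = x0) \<and>
     (\<forall>k. \<forall>\<omega>\<in>space P. sgs_step ends F L (node k \<omega>) (lam k \<omega>) (lam (Suc k) \<omega>))"

text \<open>The conditional expectation of a real random variable \<open>X\<close> given a random vector \<open>Y\<close>.\<close>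

definition cond_exp_given :: "'w measure \<Rightarrow> ('w \<Rightarrow> real^'e) \<Rightarrow> ('w \<Rightarrow> real) \<Rightarrow> 'w \<Rightarrow> real" where
  "cond_exp_given P Y X = real_cond_exp P (vimage_algebra (space P) Y borel) X"

end

theory Submission
  imports Defs
begin

text \<open>
  \<^bold>\<open>The objective.\<close> Conjugation turns an \<open>M\<close>-smooth and \<open>\<mu>\<close>-strongly convex function into a
  \<open>1 / \<mu>\<close>-smooth and \<open>1 / M\<close>-strongly convex one (\<open>smooth_strongly_convex_conjugate\<close>). Summing over the
  nodes, the dual objective \<open>F\<close> deviates from its linearization along a direction \<open>d\<close> by at least
  \<open>(norm (A *v d))\<^sup>2 / (2 * M)\<close> and at most \<open>(norm (A *v d))\<^sup>2 / (2 * \<mu>)\<close> (\<open>dual_objective_bounds\<close>). It sees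
  \<open>d\<close> only through \<open>A *v d\<close>, so \<open>d\<close> may always be replaced by its projection onto the row space of \<open>A\<close>,
  whose Euclidean norm is \<open>seminorm_A A d\<close>.

  \<^bold>\<open>The constants.\<close> On the row space the Rayleigh quotient of the Gram matrix is at least its smallest
  nonzero eigenvalue, with equality at an eigenvector (\<open>gamma_min_pos_row_space\<close>); hence
  \<open>gamma_min_pos A / M\<close> is a strong convexity constant in the seminorm, and quadratic local functions
  show that it is optimal for the class. Since every edge has two ends, twice the squared dual norm
  lies between the squared Euclidean norm and its multiple by the maximal degree
  (\<open>norm_le_dual_norm_SM\<close>, \<open>dual_norm_SM_le\<close>). On the row space, strong convexity in one norm therefore
  gives strong convexity in the other: the constant in the dual norm is at most twice the constant in
  the seminorm, and at least \<open>\<sigma>_A / max_degree ends\<close>, even with a factor \<open>2\<close> to spare.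

  \<^bold>\<open>The rate.\<close> A column of \<open>A\<close> has squared norm \<open>2\<close>, and \<open>2 \<le> gamma_max A\<close>, so a step of length \<open>1 / L\<close>
  along the best edge of the node \<open>i\<close> decreases \<open>F\<close> by at least \<open>1 / (2 * L)\<close> times the largest squared
  partial derivative among the edges at \<open>i\<close> (\<open>sgs_step_decrease\<close>). The node is uniform and independent
  of the iterate, so averaging these maxima produces the squared setwise max norm of the gradient
  divided by the number of nodes (\<open>cond_exp_given_uniform_draw\<close>). Strong convexity in the dual norm
  bounds that squared norm from below by \<open>2 * \<sigma>_SM\<close> times the optimality gap (\<open>gradient_domination\<close>).
\<close>

section \<open>Conjugates of smooth strongly convex functions\<close>

lemma smooth_strongly_convex_weaken:
  assumes "smooth_strongly_convex \<mu> M f" "0 < \<mu>'" "\<mu>' \<le> \<mu>" "M \<le> M'"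
  shows "smooth_strongly_convex \<mu>' M' f"
proof -
  have "f x + deriv f x * (y - x) + \<mu>' / 2 * (y - x)\<^sup>2 \<le> f y \<and>
        f y \<le> f x + deriv f x * (y - x) + M' / 2 * (y - x)\<^sup>2" for x y
  proof -
    have "\<mu>' / 2 * (y - x)\<^sup>2 \<le> \<mu> / 2 * (y - x)\<^sup>2" "M / 2 * (y - x)\<^sup>2 \<le> M' / 2 * (y - x)\<^sup>2"
      using assms by (auto intro!: mult_right_mono)
    then show ?thesis using assms(1) unfolding smooth_strongly_convex_def
      by (smt (verit, ccfv_SIG))
  qed
  then show ?thesis using assms unfolding smooth_strongly_convex_def by auto
qed

lemma smooth_strongly_convex_deriv_diff:
  assumes "smooth_strongly_convex \<mu> M f"
  shows "\<mu> * (y - x)\<^sup>2 \<le> (deriv f y - deriv f x) * (y - x)"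
    and "(deriv f y - deriv f x) * (y - x) \<le> M * (y - x)\<^sup>2"
proof -
  have 1: "f x + deriv f x * (y - x) + \<mu> / 2 * (y - x)\<^sup>2 \<le> f y"
    "f y \<le> f x + deriv f x * (y - x) + M / 2 * (y - x)\<^sup>2"
    and 2: "f y + deriv f y * (x - y) + \<mu> / 2 * (x - y)\<^sup>2 \<le> f x"
    "f x \<le> f y + deriv f y * (x - y) + M / 2 * (x - y)\<^sup>2"
    using assms unfolding smooth_strongly_convex_def by blast+
  have sym: "(x - y)\<^sup>2 = (y - x)\<^sup>2" by (simp add: power2_commute)
  have e: "(deriv f y - deriv f x) * (y - x) = - deriv f y * (x - y) - deriv f x * (y - x)"
    by (simp add: algebra_simps)
  show "\<mu> * (y - x)\<^sup>2 \<le> (deriv f y - deriv f x) * (y - x)"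
    using 1(1) 2(1) unfolding e sym by simp
  show "(deriv f y - deriv f x) * (y - x) \<le> M * (y - x)\<^sup>2"
    using 1(2) 2(2) unfolding e sym by simp
qed

lemma smooth_strongly_convex_deriv_lipschitz:
  assumes "smooth_strongly_convex \<mu> M f"
  shows "\<bar>deriv f y - deriv f x\<bar> \<le> M * \<bar>y - x\<bar>"
proof (cases "y = x")
  case False
  have "0 \<le> \<mu> * (y - x)\<^sup>2" using assms unfolding smooth_strongly_convex_def by auto
  then have "\<bar>deriv f y - deriv f x\<bar> * \<bar>y - x\<bar> \<le> (M * \<bar>y - x\<bar>) * \<bar>y - x\<bar>"
    using smooth_strongly_convex_deriv_diff[OF assms, of y x]
    by (simp add: abs_mult[symmetric] power2_eq_square mult.assoc)
  then show ?thesis using False by simp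
qed simp

lemma smooth_strongly_convex_continuous_deriv:
  assumes "smooth_strongly_convex \<mu> M f"
  shows "continuous_on UNIV (deriv f)"
proof -
  have "M-lipschitz_on UNIV (deriv f)"
    using smooth_strongly_convex_deriv_lipschitz[OF assms] assms
    unfolding lipschitz_on_def smooth_strongly_convex_def by (auto simp: dist_real_def)
  then show ?thesis by (rule lipschitz_on_continuous_on)
qed

text \<open>Strong monotonicity makes the derivative unbounded in both directions, so every slope \<open>y\<close> is
  attained; the point where this happens is the maximizer in the definition of the conjugate.\<close>

lemma smooth_strongly_convex_deriv_surj:
  assumes "smooth_strongly_convex \<mu> M f"
  obtains p where "deriv f p = y"
proof -
  define r where "r = \<bar>y - deriv f 0\<bar> / \<mu>"
  have \<mu>: "0 < \<mu>" using assms by (simp add: smooth_strongly_convex_def)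
  have r: "0 \<le> r" "\<mu> * r = \<bar>y - deriv f 0\<bar>" using \<mu> by (auto simp: r_def)
  have lo: "deriv f (- r) \<le> y" and hi: "y \<le> deriv f r"
  proof -
    have 1: "\<mu> * r * r \<le> (deriv f r - deriv f 0) * r"
      using smooth_strongly_convex_deriv_diff(1)[OF assms, of r 0] by (simp add: power2_eq_square mult.assoc)
    have 2: "\<mu> * r * r \<le> (deriv f 0 - deriv f (-r)) * r"
      using smooth_strongly_convex_deriv_diff(1)[OF assms, of 0 "-r"]
      by (simp add: power2_eq_square mult.assoc)
    have "deriv f (- r) \<le> y \<and> y \<le> deriv f r"
    proof (cases "r = 0")
      case True
      then show ?thesis using r by simp
    next
      case False
      then show ?thesis using 1 2 r by (auto simp: mult_le_cancel_right)
    qed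
    then show "deriv f (- r) \<le> y" "y \<le> deriv f r" by auto
  qed
  have "\<exists>p. - r \<le> p \<and> p \<le> r \<and> deriv f p = y"
    by (rule IVT'[where f = "deriv f"]) (use lo hi r smooth_strongly_convex_continuous_deriv[OF assms] in
        \<open>auto intro: continuous_on_subset\<close>)
  then show thesis using that by blast
qed

text \<open>The case \<open>z = y\<close> says that \<open>p\<close> attains the supremum in the conjugate at \<open>y\<close>. The general case
  bounds the conjugate at \<open>z\<close> from above, because strong convexity leaves a concave quadratic in
  \<open>x - p\<close>, whose maximum is read off by completing the square.\<close>

lemma fenchel_conjugate_maximizer:
  assumes "smooth_strongly_convex \<mu> M f" "deriv f p = y"
  shows "z * x - f x \<le> (y * p - f p) + p * (z - y) + 1 / \<mu> / 2 * (z - y)\<^sup>2"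
proof -
  have \<mu>: "0 < \<mu>" using assms by (simp add: smooth_strongly_convex_def)
  have "f p + y * (x - p) + \<mu> / 2 * (x - p)\<^sup>2 \<le> f x"
    using assms unfolding smooth_strongly_convex_def by blast
  moreover have "(z - y) * (x - p) \<le> 1 / \<mu> / 2 * (z - y)\<^sup>2 + \<mu> / 2 * (x - p)\<^sup>2"
  proof -
    have "0 \<le> 1 / \<mu> / 2 * ((z - y) - \<mu> * (x - p))\<^sup>2" using \<mu> by simp
    also have "\<dots> = 1 / \<mu> / 2 * (z - y)\<^sup>2 + \<mu> / 2 * (x - p)\<^sup>2 - (z - y) * (x - p)"
      using \<mu> by (simp add: field_simps power2_eq_square)
    finally show ?thesis by simp
  qed
  ultimately show ?thesis by (simp add: algebra_simps)
qed

lemma fenchel_conjugate_eq: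
  assumes "smooth_strongly_convex \<mu> M f" "deriv f p = y"
  shows "fenchel_conjugate f y = y * p - f p"
  unfolding fenchel_conjugate_def
  using fenchel_conjugate_maximizer[OF assms, of y] by (intro cSup_eq_maximum) auto

lemma fenchel_conjugate_bounds:
  assumes "smooth_strongly_convex \<mu> M f" "deriv f p = y"
  shows "fenchel_conjugate f y + p * (z - y) + 1 / M / 2 * (z - y)\<^sup>2 \<le> fenchel_conjugate f z"
    and "fenchel_conjugate f z \<le> fenchel_conjugate f y + p * (z - y) + 1 / \<mu> / 2 * (z - y)\<^sup>2"
proof -
  have M: "0 < M" using assms by (simp add: smooth_strongly_convex_def)
  obtain q where q: "deriv f q = z" by (rule smooth_strongly_convex_deriv_surj[OF assms(1)])
  \<comment> \<open>This point maximizes the quadratic lower bound that \<open>M\<close>-smoothness gives for \<open>z * x - f x\<close>.\<close>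
  define x where "x = p + (z - y) / M"
  have "f x \<le> f p + y * (x - p) + M / 2 * (x - p)\<^sup>2"
    using assms unfolding smooth_strongly_convex_def by blast
  moreover have "z * x - f x \<le> z * q - f q"
    using fenchel_conjugate_maximizer[OF assms(1) q, of z x] by simp
  moreover have "z * x - (f p + y * (x - p) + M / 2 * (x - p)\<^sup>2) =
      y * p - f p + p * (z - y) + 1 / M / 2 * (z - y)\<^sup>2"
    using M unfolding x_def by (simp add: field_simps power2_eq_square)
  ultimately show "fenchel_conjugate f y + p * (z - y) + 1 / M / 2 * (z - y)\<^sup>2 \<le> fenchel_conjugate f z"
    unfolding fenchel_conjugate_eq[OF assms] fenchel_conjugate_eq[OF assms(1) q] by linarith
  show "fenchel_conjugate f z \<le> fenchel_conjugate f y + p * (z - y) + 1 / \<mu> / 2 * (z - y)\<^sup>2"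
    using fenchel_conjugate_maximizer[OF assms, of z q]
    unfolding fenchel_conjugate_eq[OF assms] fenchel_conjugate_eq[OF assms(1) q] .
qed

lemma has_real_derivative_of_quadratic_bound:
  fixes g :: "real \<Rightarrow> real"
  assumes "\<And>z. \<bar>g z - g y - p * (z - y)\<bar> \<le> C * (z - y)\<^sup>2"
  shows "(g has_real_derivative p) (at y)"
proof -
  have "((\<lambda>z. (g z - g y) / (z - y) - p) \<longlongrightarrow> 0) (at y)"
  proof (rule Lim_null_comparison)
    show "((\<lambda>z. C * \<bar>z - y\<bar>) \<longlongrightarrow> 0) (at y)"
      by (auto intro!: tendsto_eq_intros)
    show "\<forall>\<^sub>F z in at y. norm ((g z - g y) / (z - y) - p) \<le> C * \<bar>z - y\<bar>"
      unfolding eventually_at_filter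
    proof (rule always_eventually, intro allI impI)
      fix z assume "z \<noteq> y"
      then have "(g z - g y) / (z - y) - p = (g z - g y - p * (z - y)) / (z - y)"
        by (simp add: field_simps)
      moreover have "C * (z - y)\<^sup>2 = C * \<bar>z - y\<bar> * \<bar>z - y\<bar>"
        by (simp add: power2_eq_square mult.assoc)
      ultimately show "norm ((g z - g y) / (z - y) - p) \<le> C * \<bar>z - y\<bar>"
        using assms[of z] \<open>z \<noteq> y\<close> by (metis abs_divide pos_divide_le_eq real_norm_def right_minus_eq zero_less_abs_iff)
    qed
  qed
  then show ?thesis by (simp add: has_field_derivative_iff LIM_zero_iff)
qed

text \<open>Conjugation exchanges smoothness and strong convexity: the quadratic bounds around the
  maximizer \<open>p\<close> of \<open>y * x - f x\<close> identify \<open>p\<close> as the derivative of the conjugate at \<open>y\<close>.\<close>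

lemma smooth_strongly_convex_conjugate:
  assumes "smooth_strongly_convex \<mu> M f"
  shows "smooth_strongly_convex (1 / M) (1 / \<mu>) (fenchel_conjugate f)"
proof -
  have pos: "0 < \<mu>" "\<mu> \<le> M" using assms by (auto simp: smooth_strongly_convex_def)
  have der: "(fenchel_conjugate f has_real_derivative p) (at y)" if "deriv f p = y" for p y
  proof (rule has_real_derivative_of_quadratic_bound)
    fix z
    have "0 \<le> 1 / M / 2 * (z - y)\<^sup>2" using pos by simp
    then show "\<bar>fenchel_conjugate f z - fenchel_conjugate f y - p * (z - y)\<bar> \<le> 1 / \<mu> / 2 * (z - y)\<^sup>2"
      using fenchel_conjugate_bounds[OF assms that, of z] by linarith
  qed
  have "\<exists>p. (fenchel_conjugate f has_real_derivative p) (at y) \<and> deriv f p = y" for y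
    using der smooth_strongly_convex_deriv_surj[OF assms] by metis
  then obtain p where p: "\<And>y. (fenchel_conjugate f has_real_derivative p y) (at y)"
    "\<And>y. deriv f (p y) = y" by metis
  have "deriv (fenchel_conjugate f) y = p y" for y using p(1) by (rule DERIV_imp_deriv)
  then show ?thesis
    using pos p fenchel_conjugate_bounds[OF assms p(2)] unfolding smooth_strongly_convex_def
    by (auto simp: field_differentiable_def frac_le)
qed

lemma smooth_strongly_convex_quadratic:
  assumes "0 < \<mu>" "\<mu> \<le> M"
  shows "smooth_strongly_convex \<mu> M (\<lambda>x. M / 2 * x\<^sup>2)"
proof -
  have d: "((\<lambda>x. M / 2 * x\<^sup>2) has_real_derivative M * x) (at x)" for x
    by (auto intro!: derivative_eq_intros)
  have "deriv (\<lambda>x. M / 2 * x\<^sup>2) x = M * x" for x using d by (rule DERIV_imp_deriv)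
  moreover have "M / 2 * x\<^sup>2 + M * x * (y - x) + M / 2 * (y - x)\<^sup>2 = M / 2 * y\<^sup>2" for x y
    by (simp add: field_simps power2_eq_square)
  ultimately have "smooth_strongly_convex M M (\<lambda>x. M / 2 * x\<^sup>2)"
    using assms d
    by (fastforce simp: smooth_strongly_convex_def field_differentiable_def simp del: times_divide_eq_left)
  then show ?thesis using assms by (rule smooth_strongly_convex_weaken) auto
qed

lemma fenchel_conjugate_quadratic:
  assumes "0 < M"
  shows "fenchel_conjugate (\<lambda>x. M / 2 * x\<^sup>2) y = y\<^sup>2 / (2 * M)"
proof -
  have "((\<lambda>x. M / 2 * x\<^sup>2) has_real_derivative y) (at (y / M))"
    using assms by (auto intro!: derivative_eq_intros)
  then have "deriv (\<lambda>x. M / 2 * x\<^sup>2) (y / M) = y" by (rule DERIV_imp_deriv)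
  from fenchel_conjugate_eq[OF smooth_strongly_convex_quadratic this] assms
  have "fenchel_conjugate (\<lambda>x. M / 2 * x\<^sup>2) y = y * (y / M) - M / 2 * (y / M)\<^sup>2" by blast
  then show ?thesis using assms by (simp add: field_simps power2_eq_square)
qed

section \<open>Eigenvalues of the Gram matrix\<close>

lemma gram_inner: "u \<bullet> ((transpose A ** A) *v w) = (A *v u) \<bullet> (A *v w)"
  for A :: "real^'e::finite^'n::finite"
  using dot_lmul_matrix[of "A *v w" A u]
  by (simp add: matrix_vector_mul_assoc[symmetric] inner_commute)

text \<open>Eigenvectors for distinct eigenvalues of a symmetric matrix are orthogonal, hence independent.
  Finiteness is what makes the maximum and the minimum in \<open>gamma_max\<close> and \<open>gamma_min_pos\<close> meaningful.\<close>

lemma finite_eigenvalues_gram: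
  fixes A :: "real^'e::finite^'n::finite"
  shows "finite {c. is_eigenvalue (transpose A ** A) c}"
proof -
  let ?B = "transpose A ** A" and ?E = "{c. is_eigenvalue (transpose A ** A) c}"
  obtain v where v: "\<And>c. c \<in> ?E \<Longrightarrow> v c \<noteq> 0 \<and> ?B *v v c = c *\<^sub>R v c"
    unfolding is_eigenvalue_def using bchoice[of ?E "\<lambda>c v. v \<noteq> 0 \<and> ?B *v v = c *\<^sub>R v"]
    by (auto simp: is_eigenvalue_def)
  have orth: "v c \<bullet> v d = 0" if "c \<in> ?E" "d \<in> ?E" "c \<noteq> d" for c d
  proof -
    have "c * (v d \<bullet> v c) = v d \<bullet> (?B *v v c)" using v[OF that(1)] by simp
    also have "\<dots> = v c \<bullet> (?B *v v d)" unfolding gram_inner by (rule inner_commute)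
    also have "\<dots> = d * (v d \<bullet> v c)" using v[OF that(2)] by (simp add: inner_commute)
    finally show ?thesis using that by (simp add: inner_commute)
  qed
  have "inj_on v ?E"
  proof (rule inj_onI, rule ccontr)
    fix c d assume "c \<in> ?E" "d \<in> ?E" "v c = v d" "c \<noteq> d"
    then show False using orth[of c d] v[of d] by simp
  qed
  moreover have "finite (v ` ?E)"
  proof -
    have "pairwise orthogonal (v ` ?E)"
      using orth by (auto simp: pairwise_def orthogonal_def)
    moreover have "0 \<notin> v ` ?E" using v by force
    ultimately show ?thesis
      by (intro independent_imp_finite pairwise_orthogonal_independent)
  qed
  ultimately show ?thesis by (rule finite_imageD[rotated])
qed

text \<open>A minimizer of the Rayleigh quotient over an invariant subspace is an eigenvector: the quadratic
  form \<open>s * ((norm (A *v w))\<^sup>2 - m * (norm w)\<^sup>2)\<close> in \<open>w\<close> is nonnegative on the subspace and vanishes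
  at the minimizer \<open>v\<close>, so its gradient there is orthogonal to the subspace, to which it also belongs. The sign \<open>s\<close> covers
  maximizers as well.\<close>

lemma rayleigh_extremum_eigenvector:
  fixes A :: "real^'e::finite^'n::finite"
  assumes S: "subspace S" "\<And>v. v \<in> S \<Longrightarrow> (transpose A ** A) *v v \<in> S"
    and v: "v \<in> S" "v \<noteq> 0" "norm (A *v v) ^ 2 = m * norm v ^ 2"
    and ext: "\<And>w. w \<in> S \<Longrightarrow> 0 \<le> s * (norm (A *v w) ^ 2 - m * norm w ^ 2)" and s: "s \<noteq> (0::real)"
  shows "(transpose A ** A) *v v = m *\<^sub>R v"
proof -
  define w where "w = (transpose A ** A) *v v - m *\<^sub>R v"
  have w: "w \<in> S" unfolding w_def using S v by (simp add: subspace_diff subspace_mul)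
  define a where "a = s * (w \<bullet> w)"
  define b where "b = s * (norm (A *v w) ^ 2 - m * norm w ^ 2)"
  have ww: "(A *v w) \<bullet> (A *v v) - m * (w \<bullet> v) = w \<bullet> w"
    by (simp add: gram_inner[symmetric] w_def inner_diff_right)
  have nonneg: "0 \<le> 2 * t * a + t\<^sup>2 * b" for t
  proof -
    have "v + t *\<^sub>R w \<in> S" using S v w by (simp add: subspace_add subspace_mul)
    from ext[OF this] have "0 \<le> s * (norm (A *v (v + t *\<^sub>R w)) ^ 2 - m * norm (v + t *\<^sub>R w) ^ 2)" .
    also have "norm (A *v (v + t *\<^sub>R w)) ^ 2 - m * norm (v + t *\<^sub>R w) ^ 2 =
        (norm (A *v v) ^ 2 - m * norm v ^ 2) + 2 * t * ((A *v w) \<bullet> (A *v v) - m * (w \<bullet> v))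
          + t\<^sup>2 * (norm (A *v w) ^ 2 - m * norm w ^ 2)"
      unfolding matrix_vector_right_distrib matrix_vector_mult_scaleR power2_norm_eq_inner
      by (simp add: inner_add inner_commute algebra_simps power2_eq_square)
    finally show ?thesis using v(3) unfolding ww a_def b_def by (simp add: algebra_simps)
  qed
  \<comment> \<open>A quadratic in \<open>t\<close> without constant term that is nonnegative has no linear term.\<close>
  have "a = 0"
  proof (rule ccontr)
    assume a: "a \<noteq> 0"
    define t where "t = - a / (\<bar>b\<bar> + 1)"
    have tb: "t * (\<bar>b\<bar> + 1) = - a" by (simp add: t_def add_nonneg_eq_0_iff)
    have "2 * t * a + t\<^sup>2 * b \<le> 2 * t * a + t\<^sup>2 * (\<bar>b\<bar> + 1)"
      by (intro add_left_mono mult_left_mono) auto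
    also have "t\<^sup>2 * (\<bar>b\<bar> + 1) = - t * a"
      using tb by (simp add: power2_eq_square mult.assoc)
    also have "2 * t * a + - t * a = - (a\<^sup>2 / (\<bar>b\<bar> + 1))"
      unfolding t_def by (simp add: power2_eq_square)
    also have "\<dots> < 0" using a by (auto intro!: divide_pos_pos)
    finally show False using nonneg[of t] by simp
  qed
  then have "w = 0" using s by (simp add: a_def)
  then show ?thesis by (simp add: w_def)
qed

lemma rayleigh_extremum:
  fixes A :: "real^'e::finite^'n::finite" and s :: real
  assumes S: "subspace S" "\<And>v. v \<in> S \<Longrightarrow> (transpose A ** A) *v v \<in> S"
    and "S \<noteq> {0}" "s \<noteq> 0"
  obtains v m where "v \<in> S" "v \<noteq> 0" "(transpose A ** A) *v v = m *\<^sub>R v"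
    "\<And>w. w \<in> S \<Longrightarrow> 0 \<le> s * (norm (A *v w) ^ 2 - m * norm w ^ 2)"
proof -
  let ?K = "S \<inter> sphere 0 1"
  obtain u where u: "u \<in> S" "u \<noteq> 0" using assms subspace_0 by blast
  have "compact ?K" using closed_subspace[OF S(1)] by (simp add: closed_Int_compact)
  moreover have "(1 / norm u) *\<^sub>R u \<in> ?K" using u S by (simp add: subspace_mul)
  then have "?K \<noteq> {}" by blast
  moreover have "continuous_on ?K (\<lambda>v. s * norm (A *v v) ^ 2)"
    by (intro continuous_intros matrix_vector_mult_linear_continuous_on)
  ultimately obtain v where v: "v \<in> ?K" "\<And>w. w \<in> ?K \<Longrightarrow> s * norm (A *v v) ^ 2 \<le> s * norm (A *v w) ^ 2"
    using continuous_attains_inf[of ?K "\<lambda>v. s * norm (A *v v) ^ 2"] by blast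
  define m where "m = norm (A *v v) ^ 2"
  have ext: "0 \<le> s * (norm (A *v w) ^ 2 - m * norm w ^ 2)" if "w \<in> S" for w
  proof (cases "w = 0")
    case False
    have "(1 / norm w) *\<^sub>R w \<in> ?K" using that S False by (simp add: subspace_mul)
    from v(2)[OF this] have "s * m \<le> s * (norm (A *v w) ^ 2 / norm w ^ 2)"
      by (simp add: m_def matrix_vector_mult_scaleR power_divide)
    then have "s * m * norm w ^ 2 \<le> s * (norm (A *v w) ^ 2 / norm w ^ 2) * norm w ^ 2"
      by (rule mult_right_mono) simp
    then show ?thesis using False by (simp add: algebra_simps)
  qed simp
  have "(transpose A ** A) *v v = m *\<^sub>R v"
    by (rule rayleigh_extremum_eigenvector[OF S _ _ _ ext \<open>s \<noteq> 0\<close>]) (use v in \<open>auto simp: m_def\<close>)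
  moreover have "v \<in> S" "v \<noteq> 0" using v(1) by auto
  ultimately show ?thesis using that[of v m] ext by blast
qed

lemma gram_eigenvector_norm:
  fixes A :: "real^'e::finite^'n::finite"
  assumes "(transpose A ** A) *v v = m *\<^sub>R v"
  shows "norm (A *v v) ^ 2 = m * norm v ^ 2"
  using gram_inner[of v A v] unfolding assms by (simp add: power2_norm_eq_inner)

lemma norm_mult_le_gamma_max:
  fixes A :: "real^'e::finite^'n::finite"
  shows "norm (A *v w) ^ 2 \<le> gamma_max A * norm w ^ 2"
proof -
  have ne: "(UNIV :: (real^'e) set) \<noteq> {0}"
  proof
    assume "(UNIV :: (real^'e) set) = {0}"
    then have "(1 :: real^'e) = 0" by blast
    then show False by simp
  qed
  obtain v m where "v \<noteq> 0" "(transpose A ** A) *v v = m *\<^sub>R v"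
    and max: "\<And>w. 0 \<le> -1 * (norm (A *v w) ^ 2 - m * norm w ^ 2)"
    by (rule rayleigh_extremum[OF subspace_UNIV UNIV_I ne, where A = A and s = "-1"]) (simp, blast)
  then have "m \<in> {c. is_eigenvalue (transpose A ** A) c}" unfolding is_eigenvalue_def by blast
  then have "m \<le> gamma_max A"
    unfolding gamma_max_def by (intro Max_ge finite_eigenvalues_gram)
  then have "m * norm w ^ 2 \<le> gamma_max A * norm w ^ 2" by (rule mult_right_mono) simp
  then show ?thesis using max[of w] by simp
qed

lemma subspace_row_space: "subspace (row_space A)"
  for A :: "real^'e::finite^'n::finite"
  unfolding row_space_def by (intro linear_subspace_image matrix_vector_mul_linear subspace_UNIV)

lemma gram_in_row_space: "(transpose A ** A) *v v \<in> row_space A"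
  for A :: "real^'e::finite^'n::finite"
  unfolding row_space_def by (rule range_eqI) (rule matrix_vector_mul_assoc[symmetric])

text \<open>The row space is orthogonal to the kernel of \<open>A\<close>.\<close>

lemma row_space_Int_kernel:
  fixes A :: "real^'e::finite^'n::finite"
  assumes "v \<in> row_space A" "A *v v = 0"
  shows "v = 0"
proof -
  obtain w where "v = transpose A *v w" using assms by (auto simp: row_space_def)
  then have "v \<bullet> v = w \<bullet> (A *v v)" using dot_lmul_matrix[of w A v] by simp
  then show ?thesis using assms by simp
qed

lemma row_space_nontrivial:
  fixes A :: "real^'e::finite^'n::finite"
  assumes "A \<noteq> 0"
  shows "row_space A \<noteq> {0}"
proof
  assume "row_space A = {0}"
  have "A *v v = 0" for v
  proof -
    have "(transpose A ** A) *v v = 0"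
      using gram_in_row_space[of A v] \<open>row_space A = {0}\<close> by blast
    then show ?thesis using gram_inner[of v A v] unfolding \<open>(transpose A ** A) *v v = 0\<close> by simp
  qed
  then show False using assms by (simp add: matrix_eq)
qed

text \<open>Nonzero eigenvalues of the Gram matrix have their eigenvectors in the row space, and on the row
  space the least Rayleigh quotient is itself a nonzero eigenvalue.\<close>

lemma gamma_min_pos_row_space:
  fixes A :: "real^'e::finite^'n::finite"
  assumes "A \<noteq> 0"
  shows gamma_min_pos_le: "w \<in> row_space A \<Longrightarrow> gamma_min_pos A * norm w ^ 2 \<le> norm (A *v w) ^ 2"
    and gamma_min_pos_gt_0: "0 < gamma_min_pos A"
    and gamma_min_pos_attained:
      "\<exists>v\<in>row_space A. v \<noteq> 0 \<and> norm (A *v v) ^ 2 = gamma_min_pos A * norm v ^ 2"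
proof -
  let ?E = "{c. c \<noteq> 0 \<and> is_eigenvalue (transpose A ** A) c}"
  obtain v m where v: "v \<in> row_space A" "v \<noteq> 0" "(transpose A ** A) *v v = m *\<^sub>R v"
    and min: "\<And>w. w \<in> row_space A \<Longrightarrow> 0 \<le> 1 * (norm (A *v w) ^ 2 - m * norm w ^ 2)"
    by (rule rayleigh_extremum[OF subspace_row_space gram_in_row_space row_space_nontrivial[OF assms],
          where s = 1]) (simp, rule that)
  have "m \<noteq> 0"
  proof
    assume "m = 0"
    then have "A *v v = 0" using gram_eigenvector_norm[OF v(3)] by simp
    then show False using row_space_Int_kernel[OF v(1)] v(2) by simp
  qed
  then have m: "m \<in> ?E" using v(2,3) by (auto simp: is_eigenvalue_def)
  have fin: "finite ?E" by (rule finite_subset[OF _ finite_eigenvalues_gram[of A]]) auto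
  have "gamma_min_pos A \<le> m" unfolding gamma_min_pos_def using fin m by (rule Min_le)
  then have "gamma_min_pos A * norm w ^ 2 \<le> m * norm w ^ 2" for w by (rule mult_right_mono) simp
  then show "gamma_min_pos A * norm w ^ 2 \<le> norm (A *v w) ^ 2" if "w \<in> row_space A" for w
    using min[OF that] by (smt (verit, best))
  have "gamma_min_pos A \<in> ?E" unfolding gamma_min_pos_def using fin m by (intro Min_in) auto
  then obtain u where u: "gamma_min_pos A \<noteq> 0" "u \<noteq> 0" "(transpose A ** A) *v u = gamma_min_pos A *\<^sub>R u"
    unfolding is_eigenvalue_def by blast
  have nu: "norm (A *v u) ^ 2 = gamma_min_pos A * norm u ^ 2" by (rule gram_eigenvector_norm[OF u(3)])
  have "0 \<le> gamma_min_pos A * norm u ^ 2" unfolding nu[symmetric] by simp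
  then show "0 < gamma_min_pos A" using u by (simp add: zero_le_mult_iff)
  have "(1 / gamma_min_pos A) *\<^sub>R ((transpose A ** A) *v u) \<in> row_space A"
    by (rule subspace_mul[OF subspace_row_space gram_in_row_space])
  then have "u \<in> row_space A" unfolding u(3) using u(1) by simp
  then show "\<exists>v\<in>row_space A. v \<noteq> 0 \<and> norm (A *v v) ^ 2 = gamma_min_pos A * norm v ^ 2"
    using u nu by blast
qed

section \<open>The pseudo-inverse and the projection onto the row space\<close>

lemma matrix_mult_diff_ldistrib: "A ** (B - C) = A ** B - A ** C"
  for A :: "real^'b::finite^'a::finite" and B C :: "real^'c::finite^'b"
  by (simp add: matrix_eq matrix_vector_mul_assoc[symmetric] matrix_vector_mult_diff_rdistrib
      matrix_vector_mult_diff_distrib)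

lemma matrix_mult_diff_rdistrib: "(A - B) ** C = A ** C - B ** C"
  for A B :: "real^'b::finite^'a::finite" and C :: "real^'c::finite^'b"
  by (simp add: matrix_eq matrix_vector_mul_assoc[symmetric] matrix_vector_mult_diff_rdistrib)

lemma matrix_mult_add_rdistrib: "(A + B) ** C = A ** C + B ** C"
  for A B :: "real^'b::finite^'a::finite" and C :: "real^'c::finite^'b"
  by (simp add: matrix_eq matrix_vector_mul_assoc[symmetric] matrix_vector_mult_add_rdistrib)

lemma transpose_plus: "transpose (A + B) = transpose A + transpose B"
  by (simp add: transpose_def vec_eq_iff)

lemma transpose_diff: "transpose (A - B) = transpose A - transpose B"
  by (simp add: transpose_def vec_eq_iff)

text \<open>For an orthonormal basis of the kernel, the sum of the rank-one projections onto its members is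
  symmetric and fixes exactly the kernel.\<close>

lemma kernel_projection_exists:
  fixes A :: "real^'e::finite^'n::finite"
  obtains K where "transpose K = K" "A ** K = 0" "\<And>x. A *v x = 0 \<Longrightarrow> K *v x = x"
proof -
  let ?N = "{x. A *v x = 0}"
  have sub: "subspace ?N" by (simp add: subspace_def matrix_vector_right_distrib matrix_vector_mult_scaleR)
  obtain B where B: "B \<subseteq> ?N" "pairwise orthogonal B" "\<And>x. x \<in> B \<Longrightarrow> norm x = 1"
    "independent B" "span B = ?N"
    using orthonormal_basis_subspace[OF sub] by metis
  have fin: "finite B" using independent_imp_finite[OF B(4)] .
  define K :: "real^'e^'e" where "K = (\<chi> i j. \<Sum>b\<in>B. b $ i * b $ j)"
  have K: "K *v x = (\<Sum>b\<in>B. (b \<bullet> x) *\<^sub>R b)" for x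
    by (simp add: K_def vec_eq_iff matrix_vector_mult_def inner_vec_def sum_distrib_left
        sum_distrib_right sum.swap[of _ _ B] mult_ac)
  have "transpose K = K" by (simp add: K_def transpose_def mult.commute)
  moreover have "A *v (K *v x) = 0" for x
  proof -
    have "A *v (K *v x) = (\<Sum>b\<in>B. A *v ((b \<bullet> x) *\<^sub>R b))"
      unfolding K by (rule linear_sum[OF matrix_vector_mul_linear])
    then show ?thesis using B(1) by (auto simp: matrix_vector_mult_scaleR intro!: sum.neutral)
  qed
  then have "A ** K = 0" by (simp add: matrix_eq matrix_vector_mul_assoc)
  moreover have "K *v x = x" if "A *v x = 0" for x
  proof -
    have "x \<in> span B" using that B by simp
    moreover have "K *v b = b" if "b \<in> B" for b
    proof -
      have "(\<Sum>c\<in>B. (c \<bullet> b) *\<^sub>R c) = (\<Sum>c\<in>{b}. (c \<bullet> b) *\<^sub>R c)"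
        using B(2) that fin by (intro sum.mono_neutral_right) (auto simp: pairwise_def orthogonal_def)
      then show ?thesis using B(3)[OF that] unfolding K by (simp add: norm_eq_1)
    qed
    ultimately show ?thesis
      using linear_eq_on_span[OF matrix_vector_mul_linear[of K] linear_ident, of B x] by simp
  qed
  ultimately show ?thesis using that by blast
qed

definition is_pseudo_inverse :: "real^'e^'n \<Rightarrow> real^'n^'e \<Rightarrow> bool" where
  "is_pseudo_inverse A X \<longleftrightarrow> A ** X ** A = A \<and> X ** A ** X = X \<and>
     transpose (A ** X) = A ** X \<and> transpose (X ** A) = X ** A"

text \<open>With \<open>K\<close> the orthogonal projection onto the kernel of \<open>A\<close>, the matrix \<open>transpose A ** A + K\<close> is
  invertible and the pseudo-inverse is its inverse times the transpose of \<open>A\<close>.\<close>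

lemma is_pseudo_inverse_exists:
  fixes A :: "real^'e::finite^'n::finite"
  obtains X where "is_pseudo_inverse A X"
proof -
  obtain K where K: "transpose K = K" "A ** K = 0" "\<And>x. A *v x = 0 \<Longrightarrow> K *v x = x"
    using kernel_projection_exists by blast
  have KA: "K ** transpose A = 0"
  proof -
    have "K ** transpose A = transpose (A ** K)" by (simp add: matrix_transpose_mul K(1))
    then show ?thesis by (simp add: K(2) transpose_def vec_eq_iff)
  qed
  have "A *v (K *v x) = 0" for x by (simp add: matrix_vector_mul_assoc K(2))
  then have KK: "K ** K = K" by (simp add: matrix_eq matrix_vector_mul_assoc[symmetric] K(3))
  define C where "C = transpose A ** A + K"
  have tC: "transpose C = C" by (simp add: C_def K(1) transpose_plus matrix_transpose_mul)
  have "x = 0" if "C *v x = 0" for x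
  proof -
    have "0 = (transpose A ** A) *v x + K *v x" using that by (simp add: C_def matrix_vector_mult_add_rdistrib)
    then have "0 = x \<bullet> ((transpose A ** A) *v x) + x \<bullet> (K *v x)" by (metis inner_add_right inner_zero_right)
    moreover have "x \<bullet> (K *v x) = (K *v x) \<bullet> (K *v x)"
      using gram_inner[of x K x] by (simp add: K(1) KK)
    ultimately have "0 = (A *v x) \<bullet> (A *v x) + (K *v x) \<bullet> (K *v x)" by (simp add: gram_inner)
    then have "A *v x = 0" "K *v x = 0"
      using add_nonneg_eq_0_iff[OF inner_ge_zero[of "A *v x"] inner_ge_zero[of "K *v x"]] by simp_all
    then show ?thesis using K(3) by simp
  qed
  then obtain D where DC: "D ** C = mat 1" using matrix_left_invertible_ker[of C] by blast
  then have CD: "C ** D = mat 1" by (simp add: matrix_left_right_inverse)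
  have tD: "transpose D = D"
  proof -
    have "transpose D = transpose D ** (C ** D)" by (simp add: CD)
    also have "\<dots> = transpose (C ** D) ** D" by (simp add: matrix_transpose_mul tC matrix_mul_assoc)
    finally show ?thesis by (simp add: CD)
  qed
  have CK: "C ** K = K" by (simp add: C_def matrix_mult_add_rdistrib matrix_mul_assoc[symmetric] K(2) KK)
  have KC: "K ** C = K"
    using arg_cong[OF CK, of transpose] by (simp add: matrix_transpose_mul tC K(1))
  have DK: "D ** K = K"
    using arg_cong[OF CK, of "(**) D"] by (simp add: matrix_mul_assoc DC)
  have KD: "K ** D = K"
    using arg_cong[OF KC, of "\<lambda>Z. Z ** D"] by (simp add: matrix_mul_assoc[symmetric] CD)
  define X where "X = D ** transpose A"
  have "X ** A + K = D ** C"
    by (simp add: X_def C_def matrix_add_ldistrib DK matrix_mul_assoc)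
  then have XA: "X ** A = mat 1 - K" by (simp add: DC eq_diff_eq)
  have "A ** X ** A = A - A ** K"
    by (simp add: matrix_mul_assoc[symmetric] XA matrix_mult_diff_ldistrib)
  moreover have "K ** X = 0" by (simp add: X_def matrix_mul_assoc KD KA)
  then have "X ** A ** X = X" by (simp add: XA matrix_mult_diff_rdistrib)
  moreover have "transpose (A ** X) = A ** X"
    by (simp add: X_def matrix_transpose_mul tD matrix_mul_assoc)
  moreover have "transpose (X ** A) = X ** A"
    by (simp add: XA transpose_diff K(1))
  ultimately have "is_pseudo_inverse A X" by (simp add: is_pseudo_inverse_def K(2))
  then show ?thesis by (rule that)
qed

text \<open>Uniqueness is Penrose's computation: both \<open>A ** X = A ** Y\<close> and \<open>X ** A = Y ** A\<close> follow from
  symmetry, and then \<open>X = X ** A ** X = Y ** A ** Y = Y\<close>.\<close>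

lemma is_pseudo_inverse_unique:
  fixes A :: "real^'e::finite^'n::finite"
  assumes X: "is_pseudo_inverse A X" and Y: "is_pseudo_inverse A Y"
  shows "X = Y"
proof -
  have AX: "A ** X = A ** Y"
  proof -
    have "A ** X = transpose (A ** X)" using X by (simp add: is_pseudo_inverse_def)
    also have "\<dots> = transpose ((A ** Y) ** (A ** X))"
      using Y by (simp add: is_pseudo_inverse_def matrix_mul_assoc)
    also have "\<dots> = transpose (A ** X) ** transpose (A ** Y)" by (rule matrix_transpose_mul)
    also have "\<dots> = (A ** X) ** (A ** Y)" using X Y by (simp add: is_pseudo_inverse_def)
    also have "\<dots> = A ** Y" using X by (simp add: is_pseudo_inverse_def matrix_mul_assoc)
    finally show ?thesis .
  qed
  have XA: "X ** A = Y ** A"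
  proof -
    have "X ** A = transpose (X ** A)" using X by (simp add: is_pseudo_inverse_def)
    also have "\<dots> = transpose ((X ** A) ** (Y ** A))"
      using Y by (simp add: is_pseudo_inverse_def matrix_mul_assoc[symmetric])
    also have "\<dots> = transpose (Y ** A) ** transpose (X ** A)" by (rule matrix_transpose_mul)
    also have "\<dots> = (Y ** A) ** (X ** A)" using X Y by (simp add: is_pseudo_inverse_def)
    also have "\<dots> = Y ** A" using X by (simp add: is_pseudo_inverse_def matrix_mul_assoc[symmetric])
    finally show ?thesis .
  qed
  have "X = X ** A ** X" using X by (simp add: is_pseudo_inverse_def)
  also have "\<dots> = Y ** A ** Y" unfolding XA by (simp only: matrix_mul_assoc[symmetric] AX)
  also have "\<dots> = Y" using Y by (simp add: is_pseudo_inverse_def)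
  finally show ?thesis .
qed

lemma is_pseudo_inverse_pseudo_inverse: "is_pseudo_inverse A (pseudo_inverse A)"
  for A :: "real^'e::finite^'n::finite"
proof -
  obtain X where "is_pseudo_inverse A X" by (rule is_pseudo_inverse_exists)
  then have "is_pseudo_inverse A (THE X. is_pseudo_inverse A X)"
    by (rule theI) (rule is_pseudo_inverse_unique[OF _ \<open>is_pseudo_inverse A X\<close>])
  then show ?thesis unfolding is_pseudo_inverse_def pseudo_inverse_def .
qed

definition row_proj :: "real^'e^'n \<Rightarrow> real^'e \<Rightarrow> real^'e" where
  "row_proj A x = (pseudo_inverse A ** A) *v x"

lemma mult_row_proj: "A *v row_proj A x = A *v x"
  for A :: "real^'e::finite^'n::finite"
  using is_pseudo_inverse_pseudo_inverse[of A]
  by (simp add: row_proj_def is_pseudo_inverse_def matrix_vector_mul_assoc matrix_mul_assoc)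

lemma row_proj_in_row_space: "row_proj A x \<in> row_space A"
  for A :: "real^'e::finite^'n::finite"
proof -
  have "pseudo_inverse A ** A = transpose A ** transpose (pseudo_inverse A)"
    using is_pseudo_inverse_pseudo_inverse[of A]
    by (simp add: is_pseudo_inverse_def matrix_transpose_mul)
  then have "row_proj A x = transpose A *v (transpose (pseudo_inverse A) *v x)"
    unfolding row_proj_def matrix_vector_mul_assoc by simp
  then show ?thesis unfolding row_space_def by blast
qed

lemma row_proj_id:
  fixes A :: "real^'e::finite^'n::finite"
  assumes "x \<in> row_space A"
  shows "row_proj A x = x"
proof -
  have "row_proj A x - x \<in> row_space A"
    using assms row_proj_in_row_space subspace_diff[OF subspace_row_space] by blast
  moreover have "A *v (row_proj A x - x) = 0" by (simp add: mult_row_proj matrix_vector_mult_diff_distrib)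
  ultimately show ?thesis using row_space_Int_kernel by fastforce
qed

text \<open>A symmetric idempotent matrix is an orthogonal projection, hence its quadratic form is the squared
  norm of the projected vector.\<close>

lemma seminorm_A_eq: "seminorm_A A x = norm (row_proj A x)"
  for A :: "real^'e::finite^'n::finite"
proof -
  let ?Q = "pseudo_inverse A ** A"
  have Q: "transpose ?Q = ?Q" "?Q ** ?Q = ?Q"
    using is_pseudo_inverse_pseudo_inverse[of A] by (auto simp: is_pseudo_inverse_def matrix_mul_assoc)
  then have "x \<bullet> (?Q *v x) = (?Q *v x) \<bullet> (?Q *v x)"
    using gram_inner[of x ?Q x] by simp
  then show ?thesis by (simp add: seminorm_A_def row_proj_def norm_eq_sqrt_inner)
qed

section \<open>The setwise max norm and its dual\<close>

definition setwise_max :: "('e \<Rightarrow> 'n set) \<Rightarrow> 'n \<Rightarrow> real^'e \<Rightarrow> real" where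
  "setwise_max ends i x = (if incident_edges ends i = {} then 0
     else Max ((\<lambda>l. (x $ l)\<^sup>2) ` incident_edges ends i))"

context
  fixes ends :: "'e::finite \<Rightarrow> 'n::finite set"
begin

lemma setwise_max_ge: "l \<in> incident_edges ends i \<Longrightarrow> (x $ l)\<^sup>2 \<le> setwise_max ends i x"
  by (auto simp: setwise_max_def)

lemma setwise_max_le:
  "\<lbrakk>\<And>l. l \<in> incident_edges ends i \<Longrightarrow> (x $ l)\<^sup>2 \<le> c; 0 \<le> c\<rbrakk> \<Longrightarrow> setwise_max ends i x \<le> c"
  by (auto simp: setwise_max_def)

lemma setwise_max_nonneg: "0 \<le> setwise_max ends i x"
proof (cases "incident_edges ends i = {}")
  case False
  then obtain l where "l \<in> incident_edges ends i" by blast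
  from order_trans[OF zero_le_power2 setwise_max_ge[OF this]] show ?thesis .
qed (simp add: setwise_max_def)

lemma norm_SM_power2: "(norm_SM ends x)\<^sup>2 = (\<Sum>i\<in>UNIV. setwise_max ends i x)"
  unfolding norm_SM_def setwise_max_def[symmetric] by (simp add: sum_nonneg setwise_max_nonneg)

lemma norm_SM_nonneg: "0 \<le> norm_SM ends x"
  unfolding norm_SM_def setwise_max_def[symmetric] by (simp add: sum_nonneg setwise_max_nonneg)

lemma norm_SM_scaleR_le: "norm_SM ends (c *\<^sub>R x) \<le> \<bar>c\<bar> * norm_SM ends x"
proof (rule power2_le_imp_le)
  have "setwise_max ends i (c *\<^sub>R x) \<le> c\<^sup>2 * setwise_max ends i x" for i
    by (rule setwise_max_le)
      (simp_all add: power_mult_distrib setwise_max_nonneg mult_left_mono setwise_max_ge)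
  then show "(norm_SM ends (c *\<^sub>R x))\<^sup>2 \<le> (\<bar>c\<bar> * norm_SM ends x)\<^sup>2"
    by (simp add: power_mult_distrib norm_SM_power2 sum_distrib_left sum_mono)
qed (simp add: norm_SM_nonneg)

end

text \<open>Every edge is counted at both of its ends. This is the source of the factor \<open>2\<close> between the
  squares of the setwise max norm and of the Euclidean norm; the degree enters because the maximum
  over a set of edges dominates their average.\<close>

context
  fixes ends :: "'e::finite \<Rightarrow> 'n::finite set"
  assumes two_ends: "\<forall>l. card (ends l) = 2"
begin

lemma sum_over_incident_edges:
  fixes g :: "'e \<Rightarrow> real"
  shows "(\<Sum>i\<in>UNIV. \<Sum>l\<in>incident_edges ends i. g l) = 2 * (\<Sum>l\<in>UNIV. g l)"
proof -
  have "(\<Sum>i\<in>UNIV. \<Sum>l\<in>incident_edges ends i. g l) = (\<Sum>l\<in>UNIV. \<Sum>i\<in>ends l. g l)"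
    using sum.swap_restrict[of UNIV UNIV "\<lambda>i l. g l" "\<lambda>i l. i \<in> ends l"]
    by (simp add: incident_edges_def)
  then show ?thesis by (simp add: two_ends sum_distrib_left)
qed

lemma norm_power2_eq_sum: "(norm x)\<^sup>2 = (\<Sum>l\<in>UNIV. (x $ l)\<^sup>2)" for x :: "real^'e"
  unfolding power2_norm_eq_inner by (simp add: inner_vec_def power2_eq_square)

lemma norm_SM_le_norm: "(norm_SM ends x)\<^sup>2 \<le> 2 * (norm x)\<^sup>2"
proof -
  have "setwise_max ends i x \<le> (\<Sum>l\<in>incident_edges ends i. (x $ l)\<^sup>2)" for i
  proof (rule setwise_max_le)
    show "(x $ l)\<^sup>2 \<le> (\<Sum>l\<in>incident_edges ends i. (x $ l)\<^sup>2)" if "l \<in> incident_edges ends i" for l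
      using that by (rule member_le_sum) simp_all
  qed (simp add: sum_nonneg)
  then have "(norm_SM ends x)\<^sup>2 \<le> (\<Sum>i\<in>UNIV. \<Sum>l\<in>incident_edges ends i. (x $ l)\<^sup>2)"
    unfolding norm_SM_power2 by (rule sum_mono)
  then show ?thesis by (simp add: sum_over_incident_edges norm_power2_eq_sum)
qed

lemma degree_le_max_degree: "card (incident_edges ends i) \<le> max_degree ends"
  unfolding max_degree_def by (rule Max_ge) auto

lemma max_degree_pos: "0 < max_degree ends"
proof -
  fix l :: 'e
  have "card (ends l) = 2" using two_ends by blast
  then have "ends l \<noteq> {}" by force
  then obtain i where "i \<in> ends l" by blast
  then have "l \<in> incident_edges ends i" by (simp add: incident_edges_def)
  then have "0 < card (incident_edges ends i)" by (auto simp: card_gt_0_iff)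
  then show ?thesis using degree_le_max_degree[of i] by linarith
qed

lemma norm_le_norm_SM: "2 * (norm x)\<^sup>2 \<le> max_degree ends * (norm_SM ends x)\<^sup>2"
proof -
  have "(\<Sum>l\<in>incident_edges ends i. (x $ l)\<^sup>2) \<le> max_degree ends * setwise_max ends i x" for i
  proof -
    have "(\<Sum>l\<in>incident_edges ends i. (x $ l)\<^sup>2) \<le> card (incident_edges ends i) * setwise_max ends i x"
      by (rule sum_bounded_above) (rule setwise_max_ge)
    also have "\<dots> \<le> max_degree ends * setwise_max ends i x"
      using degree_le_max_degree by (intro mult_right_mono setwise_max_nonneg) simp
    finally show ?thesis .
  qed
  then have "(\<Sum>i\<in>UNIV. \<Sum>l\<in>incident_edges ends i. (x $ l)\<^sup>2) \<le> max_degree ends * (norm_SM ends x)\<^sup>2"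
    unfolding norm_SM_power2 sum_distrib_left by (rule sum_mono)
  then show ?thesis by (simp add: sum_over_incident_edges norm_power2_eq_sum)
qed

lemma inner_le_norm_of_norm_SM_le_1:
  assumes "norm_SM ends x \<le> 1"
  shows "z \<bullet> x \<le> sqrt (max_degree ends / 2) * norm z"
proof -
  have "2 * (norm x)\<^sup>2 \<le> max_degree ends * (norm_SM ends x)\<^sup>2" by (rule norm_le_norm_SM)
  also have "\<dots> \<le> real (max_degree ends) * 1"
    using power_mono[OF assms norm_SM_nonneg, of 2] by (intro mult_left_mono) auto
  finally have "2 * (norm x)\<^sup>2 \<le> max_degree ends" by simp
  then have "norm x \<le> sqrt (max_degree ends / 2)" by (intro real_le_rsqrt) simp
  then have "norm z * norm x \<le> norm z * sqrt (max_degree ends / 2)" by (rule mult_left_mono) simp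
  then show ?thesis using norm_cauchy_schwarz[of z x] by (simp add: mult.commute)
qed

lemma dual_norm_SM_upper: "norm_SM ends x \<le> 1 \<Longrightarrow> z \<bullet> x \<le> dual_norm_SM ends z"
  unfolding dual_norm_SM_def
  by (rule cSUP_upper) (auto intro!: bdd_aboveI2 inner_le_norm_of_norm_SM_le_1)

lemma norm_SM_0: "norm_SM ends 0 = 0"
  using norm_SM_scaleR_le[of ends 0 0] norm_SM_nonneg[of ends 0] by simp

lemma dual_norm_SM_nonneg: "0 \<le> dual_norm_SM ends z"
  using dual_norm_SM_upper[of 0 z] by (simp add: norm_SM_0)

lemma dual_norm_SM_le: "(dual_norm_SM ends z)\<^sup>2 \<le> max_degree ends / 2 * (norm z)\<^sup>2"
proof -
  have "dual_norm_SM ends z \<le> sqrt (max_degree ends / 2) * norm z"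
    unfolding dual_norm_SM_def
  proof (rule cSUP_least)
    fix x assume "x \<in> {x. norm_SM ends x \<le> 1}"
    then show "z \<bullet> x \<le> sqrt (max_degree ends / 2) * norm z"
      by (intro inner_le_norm_of_norm_SM_le_1) (rule CollectD)
  next
    have "0 \<in> {x. norm_SM ends x \<le> 1}" by (simp add: norm_SM_0)
    then show "{x. norm_SM ends x \<le> 1} \<noteq> {}" by blast
  qed
  from power_mono[OF this dual_norm_SM_nonneg, of 2] show ?thesis
    by (simp add: power_mult_distrib)
qed

text \<open>The vector \<open>z\<close> itself, scaled into the unit ball of the setwise max norm, is a competitor in the
  supremum that defines the dual norm.\<close>

lemma norm_le_dual_norm_SM: "(norm z)\<^sup>2 \<le> 2 * (dual_norm_SM ends z)\<^sup>2"
proof (cases "z = 0")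
  case False
  define c where "c = 1 / (sqrt 2 * norm z)"
  have "norm_SM ends z \<le> sqrt 2 * norm z"
    by (rule power2_le_imp_le) (simp_all add: power_mult_distrib norm_SM_le_norm)
  then have "\<bar>c\<bar> * norm_SM ends z \<le> \<bar>c\<bar> * (sqrt 2 * norm z)" by (rule mult_left_mono) simp
  moreover have "\<bar>c\<bar> * (sqrt 2 * norm z) = 1" using False by (simp add: c_def)
  ultimately have "norm_SM ends (c *\<^sub>R z) \<le> 1" using norm_SM_scaleR_le[of ends c z] by linarith
  from dual_norm_SM_upper[OF this, of z] have "norm z / sqrt 2 \<le> dual_norm_SM ends z"
    using False by (simp add: c_def dot_square_norm power2_eq_square)
  from power_mono[OF this, of 2] show ?thesis by (simp add: power_divide)
qed simp

lemma inner_le_dual_norm_SM: "z \<bullet> x \<le> dual_norm_SM ends z * norm_SM ends x"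
proof (cases "norm_SM ends x = 0")
  case True
  then have "x = 0" using norm_le_norm_SM[of x] by simp
  then show ?thesis by (simp add: norm_SM_0)
next
  case False
  define c where "c = 1 / norm_SM ends x"
  have c: "0 < norm_SM ends x" "0 < c" using False norm_SM_nonneg[of ends x] by (auto simp: c_def)
  then have "norm_SM ends (c *\<^sub>R x) \<le> 1" using norm_SM_scaleR_le[of ends c x] by (simp add: c_def)
  from dual_norm_SM_upper[OF this, of z] show ?thesis using c by (simp add: c_def field_simps)
qed

end

lemma card_ends_incidence:
  assumes "is_incidence_matrix ends A"
  shows "\<forall>l. card (ends l) = 2"
proof
  fix l
  obtain i j where "i \<noteq> j" "ends l = {i, j}"
    using assms unfolding is_incidence_matrix_def by blast
  then show "card (ends l) = 2" by simp
qed

section \<open>The dual objective\<close>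

definition slope :: "real^'e^'n \<Rightarrow> ('n \<Rightarrow> real \<Rightarrow> real) \<Rightarrow> 'n \<Rightarrow> real^'e \<Rightarrow> real" where
  "slope A g i x = deriv (fenchel_conjugate (g i)) ((A *v x) $ i)"

text \<open>By weakening, all local functions may be taken with the same moduli \<open>\<mu>\<close> and \<open>M\<close>.\<close>

context
  fixes A :: "real^'e::finite^'n::finite" and g :: "'n \<Rightarrow> real \<Rightarrow> real" and \<mu> M :: real
  assumes g: "\<And>i. smooth_strongly_convex \<mu> M (g i)"
begin

lemma moduli_pos: "0 < \<mu>" "\<mu> \<le> M" "0 < M"
  using g[of undefined] by (auto simp: smooth_strongly_convex_def)

lemma conjugate_has_deriv:
  "(fenchel_conjugate (g i) has_real_derivative deriv (fenchel_conjugate (g i)) y) (at y)"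
  using smooth_strongly_convex_conjugate[OF g, of i] unfolding smooth_strongly_convex_def
  by (simp add: DERIV_deriv_iff_field_differentiable)

lemma partial_deriv_dual_objective:
  "partial_deriv (dual_objective A g) l x = (\<Sum>i\<in>UNIV. slope A g i x * A $ i $ l)"
proof -
  have "((\<lambda>t. dual_objective A g (x + t *\<^sub>R axis l 1)) has_real_derivative
      (\<Sum>i\<in>UNIV. slope A g i x * A $ i $ l)) (at 0)"
  proof -
    have "((\<lambda>t. fenchel_conjugate (g i) ((A *v x) $ i + t * A $ i $ l)) has_real_derivative
        slope A g i x * A $ i $ l) (at 0)" for i
    proof (rule DERIV_chain2[where f = "fenchel_conjugate (g i)"
          and g = "\<lambda>t. (A *v x) $ i + t * A $ i $ l"])
      show "((\<lambda>t. (A *v x) $ i + t * A $ i $ l) has_real_derivative A $ i $ l) (at 0)"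
        by (auto intro!: derivative_eq_intros)
    qed (use conjugate_has_deriv[of i "(A *v x) $ i"] in \<open>simp add: slope_def\<close>)
    moreover have "(A *v (x + t *\<^sub>R axis l 1)) $ i = (A *v x) $ i + t * A $ i $ l" for t i
      by (simp add: matrix_vector_right_distrib matrix_vector_mult_scaleR matrix_vector_mult_basis
          column_def)
    ultimately show ?thesis unfolding dual_objective_def by (auto intro: DERIV_sum)
  qed
  then show ?thesis unfolding partial_deriv_def by (rule DERIV_imp_deriv)
qed

lemma gradient_dual_objective_inner:
  "gradient (dual_objective A g) x \<bullet> d = (\<Sum>i\<in>UNIV. slope A g i x * (A *v d) $ i)"
proof -
  have "gradient (dual_objective A g) x \<bullet> d = (\<Sum>l\<in>UNIV. \<Sum>i\<in>UNIV. slope A g i x * A $ i $ l * d $ l)"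
    by (simp add: gradient_def inner_vec_def partial_deriv_dual_objective sum_distrib_right)
  also have "\<dots> = (\<Sum>i\<in>UNIV. \<Sum>l\<in>UNIV. slope A g i x * A $ i $ l * d $ l)" by (rule sum.swap)
  finally show ?thesis by (simp add: matrix_vector_mult_def sum_distrib_left mult.assoc)
qed

lemma dual_objective_bounds:
  shows dual_objective_lower: "dual_objective A g x + gradient (dual_objective A g) x \<bullet> d
      + 1 / M / 2 * (norm (A *v d))\<^sup>2 \<le> dual_objective A g (x + d)"
    and dual_objective_upper: "dual_objective A g (x + d) \<le> dual_objective A g x
      + gradient (dual_objective A g) x \<bullet> d + 1 / \<mu> / 2 * (norm (A *v d))\<^sup>2"
proof -
  let ?\<phi> = "\<lambda>i. fenchel_conjugate (g i)"
  have nd: "c * (norm (A *v d))\<^sup>2 = (\<Sum>i\<in>UNIV. c * ((A *v d) $ i)\<^sup>2)" for c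
    unfolding power2_norm_eq_inner by (simp add: inner_vec_def power2_eq_square sum_distrib_left)
  have sep: "(A *v (x + d)) $ i = (A *v x) $ i + (A *v d) $ i" for i
    by (simp add: matrix_vector_right_distrib)
  have lo: "?\<phi> i ((A *v x) $ i) + slope A g i x * (A *v d) $ i + 1 / M / 2 * ((A *v d) $ i)\<^sup>2
      \<le> ?\<phi> i ((A *v (x + d)) $ i)"
    and up: "?\<phi> i ((A *v (x + d)) $ i)
      \<le> ?\<phi> i ((A *v x) $ i) + slope A g i x * (A *v d) $ i + 1 / \<mu> / 2 * ((A *v d) $ i)\<^sup>2" for i
  proof -
    have "?\<phi> i a + deriv (?\<phi> i) a * (b - a) + 1 / M / 2 * (b - a)\<^sup>2 \<le> ?\<phi> i b \<and>
        ?\<phi> i b \<le> ?\<phi> i a + deriv (?\<phi> i) a * (b - a) + 1 / \<mu> / 2 * (b - a)\<^sup>2" for a b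
      using smooth_strongly_convex_conjugate[OF g, of i] unfolding smooth_strongly_convex_def by blast
    from this[of "(A *v x) $ i" "(A *v (x + d)) $ i"]
    show "?\<phi> i ((A *v x) $ i) + slope A g i x * (A *v d) $ i + 1 / M / 2 * ((A *v d) $ i)\<^sup>2
        \<le> ?\<phi> i ((A *v (x + d)) $ i)"
      "?\<phi> i ((A *v (x + d)) $ i)
        \<le> ?\<phi> i ((A *v x) $ i) + slope A g i x * (A *v d) $ i + 1 / \<mu> / 2 * ((A *v d) $ i)\<^sup>2"
      unfolding slope_def sep by simp_all
  qed
  show "dual_objective A g x + gradient (dual_objective A g) x \<bullet> d
      + 1 / M / 2 * (norm (A *v d))\<^sup>2 \<le> dual_objective A g (x + d)"
    unfolding gradient_dual_objective_inner nd dual_objective_def sum.distrib[symmetric]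
    by (rule sum_mono) (rule lo)
  show "dual_objective A g (x + d) \<le> dual_objective A g x
      + gradient (dual_objective A g) x \<bullet> d + 1 / \<mu> / 2 * (norm (A *v d))\<^sup>2"
    unfolding gradient_dual_objective_inner nd dual_objective_def sum.distrib[symmetric]
    by (rule sum_mono) (rule up)
qed

lemma dual_objective_row_proj: "dual_objective A g (x + row_proj A d) = dual_objective A g (x + d)"
  by (simp add: dual_objective_def matrix_vector_right_distrib mult_row_proj)

lemma gradient_row_proj:
  "gradient (dual_objective A g) x \<bullet> row_proj A d = gradient (dual_objective A g) x \<bullet> d"
  by (simp add: gradient_dual_objective_inner mult_row_proj)

lemma continuous_dual_objective: "continuous_on UNIV (dual_objective A g)"
  and continuous_partial_deriv: "continuous_on UNIV (partial_deriv (dual_objective A g) l)"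
proof -
  have lin: "continuous_on UNIV (\<lambda>x. (A *v x) $ i)" for i
    by (intro continuous_intros matrix_vector_mult_linear_continuous_on)
  have "continuous_on UNIV (fenchel_conjugate (g i))" for i
    using conjugate_has_deriv DERIV_isCont continuous_at_imp_continuous_on by blast
  then show "continuous_on UNIV (dual_objective A g)"
    unfolding dual_objective_def
    by (intro continuous_on_sum continuous_on_compose2[OF _ lin]) auto
  have "continuous_on UNIV (slope A g i)" for i
    unfolding slope_def
    by (rule continuous_on_compose2[OF smooth_strongly_convex_continuous_deriv
          [OF smooth_strongly_convex_conjugate[OF g]] lin]) auto
  then have "continuous_on UNIV (\<lambda>x. \<Sum>i\<in>UNIV. slope A g i x * A $ i $ l)"
    by (intro continuous_on_sum continuous_on_mult_right)
  then show "continuous_on UNIV (partial_deriv (dual_objective A g) l)"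
    by (simp only: partial_deriv_dual_objective[abs_def])
qed

end

section \<open>Best strong convexity constants\<close>

text \<open>One direction of positive length bounds every admissible constant, and the defining inequalities
  are closed conditions on the constant, so the supremum is itself admissible.\<close>

context
  fixes N :: "real^'e::finite \<Rightarrow> real" and V \<F> \<sigma> d
  assumes adm: "\<And>F. F \<in> \<F> \<Longrightarrow> strongly_convex_wrt N V F \<sigma>"
    and nontrivial: "\<F> \<noteq> {}" "d \<in> V" "N d \<noteq> 0"
begin

lemma bdd_above_strong_convexity: "bdd_above {\<sigma>. \<forall>F\<in>\<F>. strongly_convex_wrt N V F \<sigma>}"
proof -
  obtain F where F: "F \<in> \<F>" using nontrivial by blast
  show ?thesis
  proof (rule bdd_aboveI)
    fix \<sigma> assume "\<sigma> \<in> {\<sigma>. \<forall>F\<in>\<F>. strongly_convex_wrt N V F \<sigma>}"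
    then have "strongly_convex_wrt N V F \<sigma>" using F by blast
    then have "F d \<ge> F 0 + gradient F 0 \<bullet> (d - 0) + \<sigma> / 2 * (N (d - 0))\<^sup>2"
      using nontrivial(2) unfolding strongly_convex_wrt_def by (metis diff_zero)
    then show "\<sigma> \<le> 2 * (F d - F 0 - gradient F 0 \<bullet> d) / (N d)\<^sup>2"
      using nontrivial(3) by (simp add: pos_le_divide_eq)
  qed
qed

lemma strong_convexity_constant_ge: "\<sigma> \<le> strong_convexity_constant N V \<F>"
  unfolding strong_convexity_constant_def
  by (rule cSup_upper[OF _ bdd_above_strong_convexity]) (simp add: adm)

lemma strong_convexity_constant_least:
  assumes "\<And>s. (\<And>F. F \<in> \<F> \<Longrightarrow> strongly_convex_wrt N V F s) \<Longrightarrow> s \<le> c"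
  shows "strong_convexity_constant N V \<F> \<le> c"
  unfolding strong_convexity_constant_def by (rule cSup_least) (use adm assms in auto)

lemma strongly_convex_wrt_constant:
  assumes "F \<in> \<F>"
  shows "strongly_convex_wrt N V F (strong_convexity_constant N V \<F>)"
  unfolding strongly_convex_wrt_def
proof (intro allI impI)
  fix x y assume "y - x \<in> V"
  define D where "D = F y - F x - gradient F x \<bullet> (y - x)"
  have D: "s / 2 * (N (y - x))\<^sup>2 \<le> D" if "strongly_convex_wrt N V F s" for s
    using that \<open>y - x \<in> V\<close> unfolding strongly_convex_wrt_def D_def by (simp add: algebra_simps)
  have "strong_convexity_constant N V \<F> / 2 * (N (y - x))\<^sup>2 \<le> D"
  proof (cases "N (y - x) = 0")
    case True
    then show ?thesis using D[OF adm[OF assms]] by simp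
  next
    case False
    have "strong_convexity_constant N V \<F> \<le> 2 * D / (N (y - x))\<^sup>2"
    proof (rule strong_convexity_constant_least)
      fix s assume "\<And>F. F \<in> \<F> \<Longrightarrow> strongly_convex_wrt N V F s"
      then show "s \<le> 2 * D / (N (y - x))\<^sup>2" using D[of s] False assms by (simp add: pos_le_divide_eq)
    qed
    then show ?thesis using False by (simp add: pos_le_divide_eq)
  qed
  then show "F x + gradient F x \<bullet> (y - x) + strong_convexity_constant N V \<F> / 2 * (N (y - x))\<^sup>2 \<le> F y"
    by (simp add: D_def)
qed

end

text \<open>The functions considered below are dual objectives with common moduli. They see a direction \<open>d\<close>
  only through \<open>A *v d\<close>, so admissibility on the row space extends to all directions.\<close>

context
  fixes ends :: "'e::finite \<Rightarrow> 'n::finite set" and A :: "real^'e^'n" and \<mu> M :: real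
  assumes A: "is_incidence_matrix ends A"
begin

lemma incidence_matrix_nonzero: "A \<noteq> 0"
proof
  assume "A = 0"
  obtain i :: 'n and l :: 'e where "A $ i $ l = 1" using A unfolding is_incidence_matrix_def by blast
  then show False using \<open>A = 0\<close> by simp
qed

lemma strongly_convex_seminorm_A:
  assumes "F \<in> dual_class A \<mu> M"
  shows "strongly_convex_wrt (seminorm_A A) UNIV F (gamma_min_pos A / M)"
  unfolding strongly_convex_wrt_def
proof (intro allI impI)
  fix x y
  obtain g where g: "F = dual_objective A g" "\<And>i. smooth_strongly_convex \<mu> M (g i)"
    using assms by (auto simp: dual_class_def)
  have M: "0 < M" using moduli_pos[of \<mu> M g] g(2) by blast
  have "gamma_min_pos A * (norm (row_proj A (y - x)))\<^sup>2 \<le> (norm (A *v (y - x)))\<^sup>2"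
    using gamma_min_pos_le[OF incidence_matrix_nonzero row_proj_in_row_space, of "y - x"]
    by (simp add: mult_row_proj)
  then have "1 / M / 2 * (gamma_min_pos A * (seminorm_A A (y - x))\<^sup>2)
      \<le> 1 / M / 2 * (norm (A *v (y - x)))\<^sup>2"
    unfolding seminorm_A_eq by (rule mult_left_mono) (use M in simp)
  then show "F x + gradient F x \<bullet> (y - x) + gamma_min_pos A / M / 2 * (seminorm_A A (y - x))\<^sup>2 \<le> F y"
    using dual_objective_lower[where A = A and g = g and x = x and d = "y - x", OF g(2)] unfolding g(1) by simp
qed

lemma seminorm_A_row_space: "d \<in> row_space A \<Longrightarrow> seminorm_A A d = norm d"
  by (simp add: seminorm_A_eq row_proj_id)

text \<open>A larger norm weakens strong convexity by at most the ratio of the squared norms, so the two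
  comparisons of \<open>dual_norm_SM\<close> with the Euclidean norm carry admissible constants over in both
  directions.\<close>

lemma strongly_convex_dual_norm_SM:
  assumes "strongly_convex_wrt (seminorm_A A) UNIV F \<sigma>" "0 \<le> \<sigma>"
  shows "strongly_convex_wrt (dual_norm_SM ends) (row_space A) F (2 * \<sigma> / max_degree ends)"
  unfolding strongly_convex_wrt_def
proof (intro allI impI)
  note two = card_ends_incidence[OF A]
  fix x y assume V: "y - x \<in> row_space A"
  have deg: "0 < real (max_degree ends)" using max_degree_pos[OF two] by simp
  have "2 * \<sigma> / max_degree ends / 2 * (dual_norm_SM ends (y - x))\<^sup>2
      \<le> 2 * \<sigma> / max_degree ends / 2 * (max_degree ends / 2 * (norm (y - x))\<^sup>2)"
    using assms(2) by (intro mult_left_mono dual_norm_SM_le[OF two]) simp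
  also have "\<dots> = \<sigma> / 2 * (seminorm_A A (y - x))\<^sup>2"
    using deg by (simp add: seminorm_A_row_space[OF V])
  finally show "F x + gradient F x \<bullet> (y - x)
      + 2 * \<sigma> / max_degree ends / 2 * (dual_norm_SM ends (y - x))\<^sup>2 \<le> F y"
    using assms(1) unfolding strongly_convex_wrt_def
    by (meson UNIV_I add_left_mono order_trans)
qed

lemma strongly_convex_of_dual_norm_SM:
  assumes F: "F \<in> dual_class A \<mu> M"
    and "strongly_convex_wrt (dual_norm_SM ends) (row_space A) F \<sigma>" "0 \<le> \<sigma>"
  shows "strongly_convex_wrt (seminorm_A A) UNIV F (\<sigma> / 2)"
  unfolding strongly_convex_wrt_def
proof (intro allI impI)
  note two = card_ends_incidence[OF A]
  fix x y
  let ?d = "row_proj A (y - x)"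
  obtain g where g: "F = dual_objective A g" "\<And>i. smooth_strongly_convex \<mu> M (g i)"
    using F by (auto simp: dual_class_def)
  have s: "\<sigma> / 2 / 2 * (seminorm_A A (y - x))\<^sup>2 \<le> \<sigma> / 2 / 2 * (2 * (dual_norm_SM ends ?d)\<^sup>2)"
    unfolding seminorm_A_eq using assms(3) by (intro mult_left_mono norm_le_dual_norm_SM[OF two]) simp
  have "x + ?d - x \<in> row_space A" by (simp add: row_proj_in_row_space)
  have "F x + gradient F x \<bullet> (x + ?d - x) + \<sigma> / 2 * (dual_norm_SM ends (x + ?d - x))\<^sup>2
      \<le> F (x + ?d)"
    using assms(2) \<open>x + ?d - x \<in> row_space A\<close> unfolding strongly_convex_wrt_def by blast
  moreover have "F (x + ?d) = F y" "gradient F x \<bullet> ?d = gradient F x \<bullet> (y - x)"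
    using dual_objective_row_proj[of \<mu> M g A x "y - x"] gradient_row_proj[of \<mu> M g A x "y - x"] g(2)
    unfolding g(1) by simp_all
  ultimately show "F x + gradient F x \<bullet> (y - x) + \<sigma> / 2 / 2 * (seminorm_A A (y - x))\<^sup>2 \<le> F y"
    using s by simp
qed

lemma row_space_direction:
  obtains d where "d \<in> row_space A" "seminorm_A A d \<noteq> 0" "dual_norm_SM ends d \<noteq> 0"
proof -
  note two = card_ends_incidence[OF A]
  obtain d where d: "d \<in> row_space A" "d \<noteq> 0"
    using row_space_nontrivial[OF incidence_matrix_nonzero] subspace_0[OF subspace_row_space] by blast
  moreover have "dual_norm_SM ends d \<noteq> 0" using norm_le_dual_norm_SM[OF two, of d] d(2) by auto
  ultimately show ?thesis using that by (simp add: seminorm_A_row_space)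
qed

context
  fixes \<F>
  assumes \<F>: "\<F> \<subseteq> dual_class A \<mu> M" "\<F> \<noteq> {}"
begin

lemma modulus_pos: "0 < gamma_min_pos A / M"
proof -
  obtain F where "F \<in> dual_class A \<mu> M" using \<F> by blast
  then obtain g :: "'n \<Rightarrow> real \<Rightarrow> real" where "\<And>i. smooth_strongly_convex \<mu> M (g i)" by (auto simp: dual_class_def)
  then have "0 < M" using moduli_pos[of \<mu> M g] by blast
  then show ?thesis using gamma_min_pos_gt_0[OF incidence_matrix_nonzero] by simp
qed

lemma admissible_A: "F \<in> \<F> \<Longrightarrow> strongly_convex_wrt (seminorm_A A) UNIV F (gamma_min_pos A / M)"
  using \<F> strongly_convex_seminorm_A by blast

lemma admissible_SM: "F \<in> \<F> \<Longrightarrow> strongly_convex_wrt (dual_norm_SM ends) (row_space A) F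
    (2 * (gamma_min_pos A / M) / max_degree ends)"
  using strongly_convex_dual_norm_SM[OF admissible_A] modulus_pos by simp

lemma const_A_ge: "gamma_min_pos A / M \<le> const_A A \<F>"
proof -
  obtain d where d: "seminorm_A A d \<noteq> 0" by (rule row_space_direction)
  show ?thesis unfolding const_A_def
    by (rule strong_convexity_constant_ge[OF admissible_A \<F>(2) UNIV_I d])
qed

lemma const_SM_ge: "2 * (gamma_min_pos A / M) / max_degree ends \<le> const_SM ends A \<F>"
proof -
  obtain d where d: "d \<in> row_space A" "dual_norm_SM ends d \<noteq> 0" by (rule row_space_direction)
  show ?thesis unfolding const_SM_def
    by (rule strong_convexity_constant_ge[OF admissible_SM \<F>(2) d])
qed

lemma const_SM_pos: "0 < const_SM ends A \<F>"
  by (rule less_le_trans[OF _ const_SM_ge])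
    (intro divide_pos_pos mult_pos_pos modulus_pos,
      simp_all add: max_degree_pos[OF card_ends_incidence[OF A]])

lemma const_SM_admissible:
  "F \<in> \<F> \<Longrightarrow> strongly_convex_wrt (dual_norm_SM ends) (row_space A) F (const_SM ends A \<F>)"
proof -
  obtain d where d: "d \<in> row_space A" "dual_norm_SM ends d \<noteq> 0" by (rule row_space_direction)
  show "F \<in> \<F> \<Longrightarrow> strongly_convex_wrt (dual_norm_SM ends) (row_space A) F (const_SM ends A \<F>)"
    unfolding const_SM_def by (rule strongly_convex_wrt_constant[OF admissible_SM \<F>(2) d])
qed

lemma const_SM_le_const_A: "const_SM ends A \<F> \<le> 2 * const_A A \<F>"
proof -
  obtain d where d: "seminorm_A A d \<noteq> 0" by (rule row_space_direction)
  have "strongly_convex_wrt (seminorm_A A) UNIV F (const_SM ends A \<F> / 2)" if "F \<in> \<F>" for F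
    using strongly_convex_of_dual_norm_SM[OF _ const_SM_admissible[OF that]] that \<F>(1) const_SM_pos
    by (simp add: less_imp_le subset_iff)
  from strong_convexity_constant_ge[OF this \<F>(2) UNIV_I d] show ?thesis by (simp add: const_A_def)
qed

lemma const_SM_antimono:
  assumes "F \<in> \<F>"
  shows "const_SM ends A \<F> \<le> const_SM ends A {F}"
proof -
  obtain d where d: "d \<in> row_space A" "dual_norm_SM ends d \<noteq> 0" by (rule row_space_direction)
  show ?thesis unfolding const_SM_def[of ends A "{F}"]
    by (rule strong_convexity_constant_ge[where \<F> = "{F}" and d = d])
      (use const_SM_admissible[OF assms] d in auto)
qed

end

text \<open>The bound \<open>gamma_min_pos A / M\<close> is attained by the member of the class whose local functions are
  \<open>M / 2 * x\<^sup>2\<close>, along an eigenvector for the smallest nonzero eigenvalue.\<close>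

lemma const_A_dual_class:
  assumes "0 < \<mu>" "\<mu> \<le> M"
  shows "const_A A (dual_class A \<mu> M) = gamma_min_pos A / M"
proof (rule antisym)
  let ?q = "\<lambda>x::real. M / 2 * x\<^sup>2"
  define F where "F = dual_objective A (\<lambda>i. ?q)"
  have M: "0 < M" using assms by simp
  have q: "smooth_strongly_convex \<mu> M ?q" by (rule smooth_strongly_convex_quadratic[OF assms])
  then have F: "F \<in> dual_class A \<mu> M" by (auto simp: F_def dual_class_def)
  have F_eq: "F x = (norm (A *v x))\<^sup>2 / (2 * M)" for x
    unfolding power2_norm_eq_inner F_def dual_objective_def fenchel_conjugate_quadratic[OF M]
    by (simp add: inner_vec_def power2_eq_square sum_divide_distrib)
  obtain v where v: "v \<in> row_space A" "v \<noteq> 0" "norm (A *v v) ^ 2 = gamma_min_pos A * norm v ^ 2"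
    using gamma_min_pos_attained[OF incidence_matrix_nonzero] by blast
  have "gradient F 0 \<bullet> v = 0"
  proof -
    have "((\<lambda>x. x\<^sup>2 / (2 * M)) has_real_derivative 0) (at 0)"
      using M by (auto intro!: derivative_eq_intros)
    then have "deriv (fenchel_conjugate ?q) 0 = 0"
      unfolding fenchel_conjugate_quadratic[OF M, abs_def] by (rule DERIV_imp_deriv)
    then have "slope A (\<lambda>i. ?q) i 0 = 0" for i
      by (simp add: slope_def)
    then show ?thesis
      using gradient_dual_objective_inner[of \<mu> M "\<lambda>i. ?q" A 0 v] q by (simp add: F_def)
  qed
  show "const_A A (dual_class A \<mu> M) \<le> gamma_min_pos A / M"
    unfolding const_A_def
  proof (rule strong_convexity_constant_least)
    show "dual_class A \<mu> M \<noteq> {}" using F by blast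
    show "v \<in> UNIV" "seminorm_A A v \<noteq> 0" using v by (auto simp: seminorm_A_row_space)
    fix s assume "\<And>G. G \<in> dual_class A \<mu> M \<Longrightarrow> strongly_convex_wrt (seminorm_A A) UNIV G s"
    then have "F 0 + gradient F 0 \<bullet> (v - 0) + s / 2 * (seminorm_A A (v - 0))\<^sup>2 \<le> F v"
      using F unfolding strongly_convex_wrt_def by blast
    then have "s * (norm v)\<^sup>2 \<le> gamma_min_pos A / M * (norm v)\<^sup>2"
      using M \<open>gradient F 0 \<bullet> v = 0\<close> by (simp add: F_eq v(3) seminorm_A_row_space[OF v(1)] field_simps)
    then show "s \<le> gamma_min_pos A / M" by (rule mult_right_le_imp_le) (use v(2) in simp)
  qed (rule strongly_convex_seminorm_A)
  show "gamma_min_pos A / M \<le> const_A A (dual_class A \<mu> M)"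
    using const_A_ge[of "dual_class A \<mu> M"] F by blast
qed

end

section \<open>One step of setwise Gauss-Southwell descent\<close>

lemma norm_incidence_column:
  fixes A :: "real^'e::finite^'n::finite"
  assumes "is_incidence_matrix ends A"
  shows "(norm (A *v axis l 1))\<^sup>2 = 2"
proof -
  obtain i j where ij: "i \<noteq> j" "A $ i $ l = 1" "A $ j $ l = -1" "\<And>k. k \<notin> {i, j} \<Longrightarrow> A $ k $ l = 0"
    using assms unfolding is_incidence_matrix_def by metis
  have "(norm (A *v axis l 1))\<^sup>2 = (\<Sum>k\<in>UNIV. (A $ k $ l)\<^sup>2)"
    unfolding power2_norm_eq_inner by (simp add: inner_vec_def matrix_vector_mult_basis column_def power2_eq_square)
  also have "\<dots> = (\<Sum>k\<in>{i, j}. (A $ k $ l)\<^sup>2)"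
    by (rule sum.mono_neutral_right) (use ij(4) in auto)
  finally show ?thesis using ij by simp
qed

lemma gamma_max_ge_2:
  fixes A :: "real^'e::finite^'n::finite"
  assumes "is_incidence_matrix ends A"
  shows "2 \<le> gamma_max A"
  using norm_mult_le_gamma_max[of A "axis undefined 1"] norm_incidence_column[OF assms, of undefined]
  by simp

text \<open>Along a coordinate the curvature of the dual objective is at most \<open>2 / \<mu>\<close>, which the step size
  \<open>1 / L\<close> respects because \<open>2 \<le> gamma_max A\<close>.\<close>

lemma sgs_step_decrease:
  fixes ends :: "'e::finite \<Rightarrow> 'n::finite set" and A :: "real^'e^'n"
  assumes A: "is_incidence_matrix ends A" and g: "\<And>i. smooth_strongly_convex \<mu> M (g i)"
    and L: "L = gamma_max A / \<mu>" and step: "sgs_step ends (dual_objective A g) L i x x'"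
  shows "dual_objective A g x'
    \<le> dual_objective A g x - setwise_max ends i (gradient (dual_objective A g) x) / (2 * L)"
proof (cases "incident_edges ends i = {}")
  case True
  then show ?thesis using step by (simp add: sgs_step_def setwise_max_def)
next
  case False
  let ?F = "dual_objective A g"
  have \<mu>: "0 < \<mu>" using moduli_pos[of \<mu> M g] g by blast
  have L2: "2 / \<mu> \<le> L" unfolding L using gamma_max_ge_2[OF A] \<mu> by (simp add: divide_right_mono)
  then have L0: "0 < L" using \<mu> by (smt (verit) divide_pos_pos)
  obtain l where l: "\<And>m. m \<in> incident_edges ends i \<Longrightarrow> (partial_deriv ?F m x)\<^sup>2 \<le> (partial_deriv ?F l x)\<^sup>2"
    "x' = x - ((1 / L) * partial_deriv ?F l x) *\<^sub>R axis l 1"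
    using step False unfolding sgs_step_def by auto
  \<comment> \<open>The step moves by \<open>- p / L\<close> along \<open>l\<close>, which minimizes the quadratic model with curvature \<open>L\<close>.\<close>
  define p where "p = partial_deriv ?F l x"
  define d where "d = (- p / L) *\<^sub>R axis l (1::real)"
  have x': "x' = x + d" using l(2) by (simp add: d_def p_def)
  have slope_d: "gradient ?F x \<bullet> d = - p\<^sup>2 / L"
    by (simp add: d_def inner_axis gradient_def p_def power2_eq_square)
  have norm_d: "(norm (A *v d))\<^sup>2 = 2 * (p / L)\<^sup>2"
    unfolding d_def matrix_vector_mult_scaleR norm_scaleR power_mult_distrib
      norm_incidence_column[OF A] by (simp add: power_divide)
  have "?F x' \<le> ?F x + - p\<^sup>2 / L + 1 / \<mu> / 2 * (2 * (p / L)\<^sup>2)"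
    using dual_objective_upper[of \<mu> M g A x d] g unfolding x' slope_d norm_d by blast
  also have "1 / \<mu> / 2 * (2 * (p / L)\<^sup>2) = (2 / \<mu>) * ((p / L)\<^sup>2 / 2)" by simp
  also have "(2 / \<mu>) * ((p / L)\<^sup>2 / 2) \<le> L * ((p / L)\<^sup>2 / 2)" by (rule mult_right_mono[OF L2]) simp
  also have "L * ((p / L)\<^sup>2 / 2) = p\<^sup>2 / (2 * L)" using L0 by (simp add: power2_eq_square)
  also have "?F x + - p\<^sup>2 / L + p\<^sup>2 / (2 * L) = ?F x - p\<^sup>2 / (2 * L)" using L0 by (simp add: field_simps)
  finally have "?F x' \<le> ?F x - p\<^sup>2 / (2 * L)" by simp
  moreover have "setwise_max ends i (gradient ?F x) \<le> p\<^sup>2"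
    by (rule setwise_max_le) (use l(1) in \<open>simp_all add: gradient_def p_def\<close>)
  then have "setwise_max ends i (gradient ?F x) / (2 * L) \<le> p\<^sup>2 / (2 * L)"
    using L0 by (intro divide_right_mono) simp_all
  ultimately show ?thesis by linarith
qed

text \<open>Any node could have been drawn, so its guaranteed decrease, too, is limited by the minimum of the
  objective. This bounds the gradient terms of all nodes at once.\<close>

lemma sgs_step_exists: "\<exists>x'. sgs_step ends F L i x x'"
  for ends :: "'e::finite \<Rightarrow> 'n set"
proof (cases "incident_edges ends i = {}")
  case False
  let ?g = "\<lambda>m. (partial_deriv F m x)\<^sup>2"
  have "Max (?g ` incident_edges ends i) \<in> ?g ` incident_edges ends i" using False by (intro Max_in) auto
  then obtain l where l: "l \<in> incident_edges ends i" "Max (?g ` incident_edges ends i) = ?g l" by blast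
  have "\<forall>m\<in>incident_edges ends i. ?g m \<le> ?g l" unfolding l(2)[symmetric] by simp
  with l(1) have "\<exists>l\<in>incident_edges ends i. \<forall>m\<in>incident_edges ends i. ?g m \<le> ?g l" by blast
  then show ?thesis using False unfolding sgs_step_def by auto
qed (simp add: sgs_step_def)

text \<open>Strong convexity bounds the optimality gap by the squared norm of the gradient: minimize the
  lower bound over the direction \<open>d\<close> and its length. The value at \<open>y\<close> is also reached from \<open>x\<close>
  by a direction in the row space, since the objective is blind to the kernel of \<open>A\<close>.\<close>

lemma gradient_domination:
  fixes ends :: "'e::finite \<Rightarrow> 'n::finite set" and A :: "real^'e^'n"
  assumes A: "is_incidence_matrix ends A" and g: "\<And>i. smooth_strongly_convex \<mu> M (g i)"
    and F: "F = dual_objective A g"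
    and sc: "strongly_convex_wrt (dual_norm_SM ends) (row_space A) F \<sigma>" "0 < \<sigma>"
  shows "2 * \<sigma> * (F x - F y) \<le> (norm_SM ends (gradient F x))\<^sup>2"
proof -
  note two = card_ends_incidence[OF A]
  define d where "d = row_proj A (y - x)"
  define D G where "D = dual_norm_SM ends d" and "G = norm_SM ends (gradient F x)"
  have "x + d - x \<in> row_space A" by (simp add: d_def row_proj_in_row_space)
  then have "F x + gradient F x \<bullet> (x + d - x) + \<sigma> / 2 * (dual_norm_SM ends (x + d - x))\<^sup>2 \<le> F (x + d)"
    using sc(1) unfolding strongly_convex_wrt_def by blast
  moreover have "F (x + d) = F y"
    using dual_objective_row_proj[of \<mu> M g A x "y - x"] g by (simp add: d_def F)
  moreover have "- (gradient F x \<bullet> d) \<le> D * G"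
  proof -
    have "d \<bullet> ((-1) *\<^sub>R gradient F x) \<le> D * norm_SM ends ((-1) *\<^sub>R gradient F x)"
      unfolding D_def by (rule inner_le_dual_norm_SM[OF two])
    also have "\<dots> \<le> D * G"
      using norm_SM_scaleR_le[of ends "-1" "gradient F x"] dual_norm_SM_nonneg[OF two, of d]
      by (intro mult_left_mono) (simp_all add: D_def G_def)
    finally show ?thesis by (simp add: inner_commute)
  qed
  ultimately have "F x - F y \<le> D * G - \<sigma> / 2 * D\<^sup>2" by (simp add: D_def)
  then have "2 * \<sigma> * (F x - F y) \<le> 2 * \<sigma> * (D * G - \<sigma> / 2 * D\<^sup>2)" using sc(2) by simp
  also have "\<dots> = G\<^sup>2 - (G - \<sigma> * D)\<^sup>2" by (simp add: field_simps power2_eq_square)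
  also have "\<dots> \<le> G\<^sup>2" by simp
  finally show ?thesis by (simp add: G_def)
qed

section \<open>Averaging over an independent uniform draw\<close>

lemma subalgebra_vimage_algebra:
  assumes "Y \<in> measurable P N"
  shows "subalgebra P (vimage_algebra (space P) Y N)"
  unfolding subalgebra_def using sets_image_in_sets[OF refl assms] by simp

text \<open>Splitting \<open>h (D \<omega>) (Y \<omega>)\<close> over the values of the draw \<open>D\<close>, the factor \<open>h i (Y \<omega>)\<close> is known given \<open>Y\<close>,
  and the event \<open>D \<omega> = i\<close>, being independent of \<open>Y\<close>, has conditional probability \<open>1 / CARD('n)\<close>.\<close>

lemma cond_exp_given_uniform_draw:
  fixes P :: "'w measure" and Y :: "'w \<Rightarrow> real^'e::finite" and D :: "'w \<Rightarrow> 'n::finite"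
    and h :: "'n \<Rightarrow> real^'e \<Rightarrow> real"
  assumes P: "prob_space P" and Y [measurable]: "Y \<in> borel_measurable P"
    and D [measurable]: "D \<in> measurable P (count_space UNIV)"
    and unif: "distr P (count_space UNIV) D = uniform_count_measure UNIV"
    and indep: "\<And>B i. B \<in> sets borel \<Longrightarrow>
      measure P (Y -` B \<inter> space P \<inter> (D -` {i} \<inter> space P)) =
      measure P (Y -` B \<inter> space P) * measure P (D -` {i} \<inter> space P)"
    and h [measurable]: "\<And>i. h i \<in> borel_measurable borel"
    and int: "\<And>i. integrable P (\<lambda>\<omega>. h i (Y \<omega>))"
  shows "AE \<omega> in P. cond_exp_given P Y (\<lambda>\<omega>. h (D \<omega>) (Y \<omega>)) \<omega> = (\<Sum>i\<in>UNIV. h i (Y \<omega>)) / CARD('n)"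
    and "integrable P (\<lambda>\<omega>. h (D \<omega>) (Y \<omega>))"
proof -
  interpret prob_space P by (rule P)
  let ?G = "vimage_algebra (space P) Y borel"
  interpret finite_measure_subalgebra P ?G
    by unfold_locales (rule subalgebra_vimage_algebra[OF Y])
  define E where "E i = D -` {i} \<inter> space P" for i
  have E [measurable]: "E i \<in> sets P" for i unfolding E_def by measurable
  have prob_E: "prob (E i) = 1 / CARD('n)" for i
    using measure_distr[OF D, of "{i}"] unfolding E_def unif
    by (simp add: measure_uniform_count_measure)
  have Y_G: "Y \<in> measurable ?G borel" by (rule measurable_vimage_algebra1) simp
  have cond_E: "AE \<omega> in P. real_cond_exp P ?G (indicator (E i)) \<omega> = 1 / CARD('n)" for i
  proof (rule real_cond_exp_charact)
    fix C assume "C \<in> sets ?G"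
    then obtain B where B: "B \<in> sets borel" "C = Y -` B \<inter> space P"
      by (subst (asm) sets_vimage_algebra2) auto
    then have C: "C \<in> sets P" by simp
    have "(LINT \<omega>:C|P. indicator (E i) \<omega>) = (LINT \<omega>|P. indicator (C \<inter> E i) \<omega>)"
      unfolding set_lebesgue_integral_def by (intro Bochner_Integration.integral_cong) (auto simp: indicator_def)
    also have "\<dots> = prob (C \<inter> E i)" using C by (simp add: measure_nonneg)
    also have "\<dots> = prob C * prob (E i)" unfolding B(2) E_def by (rule indep[OF B(1)])
    also have "\<dots> = (LINT \<omega>:C|P. 1 / CARD('n))" using C by (simp add: prob_E set_lebesgue_integral_def)
    finally show "(LINT \<omega>:C|P. indicator (E i) \<omega>) = (LINT \<omega>:C|P. 1 / real CARD('n))" .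
  qed (auto intro: integrable_real_indicator simp: emeasure_eq_measure)
  have int_i: "integrable P (\<lambda>\<omega>. h i (Y \<omega>) * indicator (E i) \<omega>)" for i
    using integrable_mult_indicator[OF E int, of i i] by (simp add: mult.commute)
  have "AE \<omega> in P. real_cond_exp P ?G (\<lambda>\<omega>. h i (Y \<omega>) * indicator (E i) \<omega>) \<omega> = h i (Y \<omega>) / CARD('n)" for i
  proof -
    have "(\<lambda>\<omega>. h i (Y \<omega>)) \<in> borel_measurable ?G" by (rule measurable_compose[OF Y_G h])
    from real_cond_exp_mult[OF this _ int_i] cond_E[of i] show ?thesis by auto
  qed
  then have known: "AE \<omega> in P. \<forall>i\<in>UNIV. real_cond_exp P ?G (\<lambda>\<omega>. h i (Y \<omega>) * indicator (E i) \<omega>) \<omega>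
      = h i (Y \<omega>) / CARD('n)"
    by (intro AE_finite_allI) auto
  have linear: "AE \<omega> in P. real_cond_exp P ?G (\<lambda>\<omega>. \<Sum>i\<in>UNIV. h i (Y \<omega>) * indicator (E i) \<omega>) \<omega>
      = (\<Sum>i\<in>UNIV. real_cond_exp P ?G (\<lambda>\<omega>. h i (Y \<omega>) * indicator (E i) \<omega>) \<omega>)"
    by (rule real_cond_exp_sum) (rule int_i)
  have split: "h (D \<omega>) (Y \<omega>) = (\<Sum>i\<in>UNIV. h i (Y \<omega>) * indicator (E i) \<omega>)"
    if "\<omega> \<in> space P" for \<omega>
    using that by (simp add: E_def indicator_def if_distrib cong: if_cong)
  have int_sum: "integrable P (\<lambda>\<omega>. \<Sum>i\<in>UNIV. h i (Y \<omega>) * indicator (E i) \<omega>)"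
    by (rule Bochner_Integration.integrable_sum) (rule int_i)
  show int_h: "integrable P (\<lambda>\<omega>. h (D \<omega>) (Y \<omega>))"
    by (rule Bochner_Integration.integrable_cong[OF refl split, THEN iffD2]) (assumption, rule int_sum)
  have "AE \<omega> in P. real_cond_exp P ?G (\<lambda>\<omega>. h (D \<omega>) (Y \<omega>)) \<omega> =
      real_cond_exp P ?G (\<lambda>\<omega>. \<Sum>i\<in>UNIV. h i (Y \<omega>) * indicator (E i) \<omega>) \<omega>"
    by (rule real_cond_exp_cong[OF AE_I2[OF split]
          borel_measurable_integrable[OF int_h] borel_measurable_integrable[OF int_sum]])
  then show "AE \<omega> in P. cond_exp_given P Y (\<lambda>\<omega>. h (D \<omega>) (Y \<omega>)) \<omega> = (\<Sum>i\<in>UNIV. h i (Y \<omega>)) / CARD('n)"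
    using known linear unfolding cond_exp_given_def
    by eventually_elim (simp add: sum_divide_distrib)
qed

lemma cond_exp_given_mono:
  fixes Y :: "'w \<Rightarrow> real^'e::finite"
  assumes "prob_space P" "Y \<in> borel_measurable P"
    and "\<And>\<omega>. \<omega> \<in> space P \<Longrightarrow> U \<omega> \<le> W \<omega>" "integrable P U" "integrable P W"
  shows "AE \<omega> in P. cond_exp_given P Y U \<omega> \<le> cond_exp_given P Y W \<omega>"
proof -
  interpret prob_space P by fact
  interpret finite_measure_subalgebra P "vimage_algebra (space P) Y borel"
    by unfold_locales (rule subalgebra_vimage_algebra[OF assms(2)])
  show ?thesis unfolding cond_exp_given_def by (rule real_cond_exp_mono) (use assms in auto)
qed

section \<open>Convergence of setwise Gauss-Southwell descent\<close>

text \<open>The draw is independent of the whole history, of which the current iterate is a component.\<close>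

lemma sgs_cd_process_indep:
  fixes ends :: "'e::finite \<Rightarrow> 'n::finite set"
  assumes proc: "sgs_cd_process ends F L x0 P lam node" and B: "B \<in> sets borel"
  shows "measure P (lam k -` B \<inter> space P \<inter> (node k -` {i} \<inter> space P)) =
    measure P (lam k -` B \<inter> space P) * measure P (node k -` {i} \<inter> space P)"
proof -
  interpret prob_space P using proc by (simp add: sgs_cd_process_def)
  let ?H = "vimage_algebra (space P) (\<lambda>\<omega>. \<lambda>j\<in>{..k}. lam j \<omega>) (Pi\<^sub>M {..k} (\<lambda>_. borel))"
  let ?N = "vimage_algebra (space P) (node k) (count_space UNIV)"
  have "(\<lambda>\<omega>. \<lambda>j\<in>{..k}. lam j \<omega>) \<in> measurable ?H (Pi\<^sub>M {..k} (\<lambda>_. borel))"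
    by (rule measurable_vimage_algebra1) (auto simp: space_PiM)
  from measurable_compose[OF this measurable_component_singleton[of k "{..k}"]]
  have "lam k \<in> measurable ?H borel" by simp
  from measurable_sets[OF this B] have "lam k -` B \<inter> space P \<in> sets ?H" by simp
  moreover have "node k -` {i} \<inter> space P \<in> sets ?N" by (rule in_vimage_algebra) simp
  moreover have "indep_set (sets ?H) (sets ?N)" using proc by (simp add: sgs_cd_process_def)
  ultimately show ?thesis by (simp add: indep_setD)
qed

text \<open>Averaging the guaranteed decrease over the nodes turns the setwise maxima into the squared
  setwise max norm of the gradient, which dominates the optimality gap. Along the process the
  objective stays between its minimum and its initial value, so every random variable involved is
  bounded and hence integrable.\<close>

lemma sgs_cd_expected_decrease:
  fixes ends :: "'e::finite \<Rightarrow> 'n::finite set" and A :: "real^'e^'n"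
    and P :: "'w measure" and lam :: "nat \<Rightarrow> 'w \<Rightarrow> real^'e"
  assumes A: "is_incidence_matrix ends A" and g: "\<And>i. smooth_strongly_convex \<mu> M (g i)"
    and F: "F = dual_objective A g" and L: "L = gamma_max A / \<mu>"
    and sc: "strongly_convex_wrt (dual_norm_SM ends) (row_space A) F \<sigma>" "0 < \<sigma>"
    and min: "\<And>x. F lam_star \<le> F x"
    and proc: "sgs_cd_process ends F L x0 P lam node"
  shows "AE \<omega> in P. cond_exp_given P (lam k) (\<lambda>\<omega>. F (lam (Suc k) \<omega>)) \<omega> - F lam_star
    \<le> (1 - \<sigma> / (L * real CARD('n))) * (F (lam k \<omega>) - F lam_star)"
proof -
  interpret prob_space P using proc by (simp add: sgs_cd_process_def)
  have lam [measurable]: "lam j \<in> borel_measurable P"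
    and node: "node j \<in> measurable P (count_space UNIV)"
      "distr P (count_space UNIV) (node j) = uniform_count_measure UNIV"
    and start: "\<omega> \<in> space P \<Longrightarrow> lam 0 \<omega> = x0"
    and step: "\<omega> \<in> space P \<Longrightarrow> sgs_step ends F L (node j \<omega>) (lam j \<omega>) (lam (Suc j) \<omega>)" for j \<omega>
    using proc by (auto simp: sgs_cd_process_def)
  have "0 < \<mu>" using moduli_pos[of \<mu> M g] g by blast
  then have L0: "0 < L" unfolding L using gamma_max_ge_2[OF A] by simp
  define h where "h i x = F x - setwise_max ends i (gradient F x) / (2 * L)" for i x
  have decrease: "F x' \<le> h i x" if "sgs_step ends F L i x x'" for i x x'
    using sgs_step_decrease[where g = g, OF A g L] that unfolding F h_def by blast
  have h_le: "h i x \<le> F x" for i x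
    using L0 setwise_max_nonneg[of ends i "gradient F x"] by (simp add: h_def)
  \<comment> \<open>\<open>h i x\<close> dominates the objective after an actual step from \<open>x\<close>.\<close>
  have h_ge: "F lam_star \<le> h i x" for i x
    using sgs_step_exists[of ends F L i x] decrease min order_trans by blast
  have F_le: "F (lam j \<omega>) \<le> F x0" if "\<omega> \<in> space P" for j \<omega>
  proof (induction j)
    case (Suc j)
    have "F (lam (Suc j) \<omega>) \<le> F (lam j \<omega>)"
      using decrease[OF step[OF that]] h_le order_trans by blast
    then show ?case using Suc by simp
  qed (simp add: start[OF that])
  have F_meas [measurable]: "F \<in> borel_measurable borel"
    unfolding F using continuous_dual_objective[of \<mu> M g A] g by (intro borel_measurable_continuous_onI) blast
  have partial_meas: "(\<lambda>x. gradient F x $ l) \<in> borel_measurable borel" for l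
    unfolding F gradient_def vec_lambda_beta using continuous_partial_deriv[of \<mu> M g A l] g
    by (intro borel_measurable_continuous_onI) blast
  have max_meas: "(\<lambda>x. setwise_max ends i (gradient F x)) \<in> borel_measurable borel" for i
    unfolding setwise_max_def
    by (cases "incident_edges ends i = {}")
      (simp_all add: borel_measurable_Max borel_measurable_power partial_meas)
  have h_meas [measurable]: "h i \<in> borel_measurable borel" for i
    unfolding h_def[abs_def] using max_meas by measurable
  define c where "c = \<bar>F lam_star\<bar> + \<bar>F x0\<bar>"
  have int_F: "integrable P (\<lambda>\<omega>. F (lam j \<omega>))" for j
  proof (rule integrable_const_bound)
    show "AE \<omega> in P. norm (F (lam j \<omega>)) \<le> c"
    proof (rule AE_I2)
      fix \<omega> assume "\<omega> \<in> space P"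
      from F_le[OF this, of j] min[of "lam j \<omega>"] show "norm (F (lam j \<omega>)) \<le> c" by (simp add: c_def)
    qed
  qed measurable
  have int_h: "integrable P (\<lambda>\<omega>. h i (lam k \<omega>))" for i
  proof (rule integrable_const_bound)
    show "AE \<omega> in P. norm (h i (lam k \<omega>)) \<le> c"
    proof (rule AE_I2)
      fix \<omega> assume "\<omega> \<in> space P"
      from F_le[OF this, of k] h_le[of i "lam k \<omega>"] h_ge[of i "lam k \<omega>"]
      show "norm (h i (lam k \<omega>)) \<le> c" by (simp add: c_def)
    qed
  qed measurable
  have draw: "AE \<omega> in P. cond_exp_given P (lam k) (\<lambda>\<omega>. h (node k \<omega>) (lam k \<omega>)) \<omega>
        = (\<Sum>i\<in>UNIV. h i (lam k \<omega>)) / CARD('n)"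
      "integrable P (\<lambda>\<omega>. h (node k \<omega>) (lam k \<omega>))"
    by (rule cond_exp_given_uniform_draw[where h = h, OF prob_space_axioms lam node
        sgs_cd_process_indep[OF proc] h_meas int_h], assumption)+
  have average: "(\<Sum>i\<in>UNIV. h i x) / CARD('n) - F lam_star
      \<le> (1 - \<sigma> / (L * real CARD('n))) * (F x - F lam_star)" for x
  proof -
    have "2 * \<sigma> * (F x - F lam_star) \<le> (\<Sum>i\<in>UNIV. setwise_max ends i (gradient F x))"
      using gradient_domination[where g = g, OF A g F sc] by (simp add: norm_SM_power2)
    then have "2 * \<sigma> * (F x - F lam_star) / (2 * L * CARD('n))
        \<le> (\<Sum>i\<in>UNIV. setwise_max ends i (gradient F x)) / (2 * L * CARD('n))"
      using L0 by (intro divide_right_mono) simp_all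
    moreover have "(\<Sum>i\<in>UNIV. h i x) / CARD('n)
        = F x - (\<Sum>i\<in>UNIV. setwise_max ends i (gradient F x)) / (2 * L * CARD('n))"
      by (simp add: h_def sum_subtractf sum_divide_distrib[symmetric] diff_divide_distrib)
    moreover have "2 * \<sigma> * (F x - F lam_star) / (2 * L * CARD('n))
        = \<sigma> / (L * CARD('n)) * (F x - F lam_star)" by simp
    ultimately show ?thesis by (simp add: left_diff_distrib)
  qed
  have "AE \<omega> in P. cond_exp_given P (lam k) (\<lambda>\<omega>. F (lam (Suc k) \<omega>)) \<omega>
      \<le> cond_exp_given P (lam k) (\<lambda>\<omega>. h (node k \<omega>) (lam k \<omega>)) \<omega>"
    by (rule cond_exp_given_mono[OF prob_space_axioms lam decrease[OF step] int_F draw(2)])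
  with draw(1) show ?thesis
  proof eventually_elim
    case (elim \<omega>)
    then show ?case using average[of "lam k \<omega>"] by simp
  qed
qed

theorem theorem2:
  fixes ends :: "'e::finite \<Rightarrow> 'n::finite set"
    and A :: "real^'e^'n"
    and f :: "'n \<Rightarrow> real \<Rightarrow> real"
    and \<mu> M :: "'n \<Rightarrow> real"
    and F :: "real^'e \<Rightarrow> real"
    and \<mu>_min M_max L \<sigma>_A \<sigma>_SM :: real
    and \<F> :: "(real^'e \<Rightarrow> real) set"
    and lam_star x0 :: "real^'e"
    and P :: "'w measure"
    and lam :: "nat \<Rightarrow> 'w \<Rightarrow> real^'e"
    and node :: "nat \<Rightarrow> 'w \<Rightarrow> 'n"
  assumes "is_incidence_matrix ends A"
    and "\<And>i. smooth_strongly_convex (\<mu> i) (M i) (f i)"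
    and "\<mu>_min = Min (range \<mu>)" and "M_max = Max (range M)"
    and "F = dual_objective A f"
    and "\<F> = dual_class A \<mu>_min M_max"
    and "L = gamma_max A / \<mu>_min"
    and "\<sigma>_A = gamma_min_pos A / M_max"
    and "\<sigma>_SM = const_SM ends A {F}"
    and "\<And>x. F lam_star \<le> F x"
    and "sgs_cd_process ends F L x0 P lam node"
  shows "(\<forall>k. AE \<omega> in P.
            cond_exp_given P (lam k) (\<lambda>\<omega>. F (lam (Suc k) \<omega>)) \<omega> - F lam_star
              \<le> (1 - \<sigma>_SM / (L * real CARD('n))) * (F (lam k \<omega>) - F lam_star))
       \<and> strongly_convex_wrt (dual_norm_SM ends) (row_space A) F \<sigma>_SM
       \<and> \<sigma>_A / real (max_degree ends) \<le> \<sigma>_SM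
       \<and> \<sigma>_SM \<le> 2 * const_A A {F} \<and> \<sigma>_A \<le> const_A A {F}
       \<and> const_A A \<F> = \<sigma>_A
       \<and> \<sigma>_A / real (max_degree ends) \<le> const_SM ends A \<F>
       \<and> const_SM ends A \<F> \<le> 2 * \<sigma>_A
       \<and> const_SM ends A \<F> \<le> \<sigma>_SM"
proof -
  note A = assms(1)
  have "Min (range \<mu>) \<in> range \<mu>" by (rule Min_in) auto
  then have \<mu>_pos: "0 < \<mu>_min"
    using assms(2) unfolding assms(3) smooth_strongly_convex_def by force
  have f: "smooth_strongly_convex \<mu>_min M_max (f i)" for i
    by (rule smooth_strongly_convex_weaken[OF assms(2) \<mu>_pos]) (auto simp: assms(3,4))
  have moduli: "\<mu>_min \<le> M_max" using f[of undefined] by (simp add: smooth_strongly_convex_def)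
  have mem: "F \<in> \<F>" using f unfolding assms(5,6) dual_class_def by blast
  have sub: "{F} \<subseteq> dual_class A \<mu>_min M_max" "{F} \<noteq> {}"
    and full: "\<F> \<subseteq> dual_class A \<mu>_min M_max" "\<F> \<noteq> {}"
    using mem by (auto simp: assms(6))
  have sc: "strongly_convex_wrt (dual_norm_SM ends) (row_space A) F \<sigma>_SM"
    unfolding assms(9) by (rule const_SM_admissible[OF A sub]) simp
  have pos: "0 < \<sigma>_SM" unfolding assms(9) by (rule const_SM_pos[OF A sub])
  have weaker: "\<sigma>_A / real (max_degree ends) \<le> 2 * \<sigma>_A / real (max_degree ends)"
    using modulus_pos[OF A sub] by (intro divide_right_mono) (simp_all add: assms(8))
  have const_\<F>: "const_A A \<F> = \<sigma>_A"
    unfolding assms(6,8) by (rule const_A_dual_class[OF A \<mu>_pos moduli])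
  have "\<sigma>_A / real (max_degree ends) \<le> \<sigma>_SM"
    using weaker const_SM_ge[OF A sub] unfolding assms(8,9) by (rule order_trans)
  moreover have "\<sigma>_A / real (max_degree ends) \<le> const_SM ends A \<F>"
    using weaker const_SM_ge[OF A full] unfolding assms(8) by (rule order_trans)
  moreover have "\<sigma>_SM \<le> 2 * const_A A {F}"
    unfolding assms(9) by (rule const_SM_le_const_A[OF A sub])
  moreover have "const_SM ends A \<F> \<le> 2 * \<sigma>_A"
    using const_SM_le_const_A[OF A full] unfolding const_\<F> .
  moreover have "\<sigma>_A \<le> const_A A {F}"
    unfolding assms(8) by (rule const_A_ge[OF A sub])
  moreover have "const_SM ends A \<F> \<le> \<sigma>_SM"
    unfolding assms(9) by (rule const_SM_antimono[OF A full mem])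
  ultimately show ?thesis
    using sgs_cd_expected_decrease[where g = f, OF A f assms(5,7) sc pos assms(10,11)] sc const_\<F> by blast
qed

end
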